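(* Suppose the state is $S=(S_e,S_e')$ and the main channel is deterministic, i.e. $P_{YZ|XS}=\mathbb{I}\{Y=y(X,S_e)\}\,P_{Z|XS_eS_e'}$ for some function $y:\mathcal{X}\times\mathcal{S}_e\to\mathcal{Y}$. Then for $D\ge0$ the distribution-preserving capacity-distortion tradeoff region without common randomness equals $$C_{NCR}(D,0)=\left\{(R,0)\in\mathbb{R}^2:\ R\ge0,\ \exists\,P_{XS_eS_e'YZ\hat S}\in\mathcal{P}_{NCR}^{DE}\text{ such that } R\le H(Y|S_e),\ D\ge\mathbb{E}[d(S,\hat S)]\right\}.$$
   Context: All alphabets $\mathcal{S}_e,\mathcal{S}_e',\mathcal{S}=\hat{\mathcal{S}}=\mathcal{S}_e\times\mathcal{S}_e',\mathcal{X},\mathcal{Y},\mathcal{Z}$ are finite. Given are a distribution $P_{S_eS_e'}$ (so $P_S=P_{S_eS_e'}$), the channel, and a distortion measure $d:\mathcal{S}\times\hat{\mathcal{S}}\to[0,\infty)$ with $d(s^n,\hat s^n)=\frac1n\sum_{i=1}^nd(s_i,\hat s_i)$. The states $S_i=(S_{e,i},S'_{e,i})$ are i.i.d. $\sim P_S$, and the channel is memoryless: given $X^n,S^n$, the pair $(Y^n,Z^n)$ has law $\prod_iP_{YZ|XS}$. $Y^n$ is the receiver's output, and $Z^n$ is feedback to the state estimator at the sender. A code without common randomness (an $(n,R,0)$ code) consists of: a message $M$ uniform on $\mathcal{M}=[1:2^{nR}]$, independent of $S^n$; a (possibly stochastic) encoder mapping $(M,S_e^n)$ to $X^n$ (noncausal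 knowledge of $S_e^n$); a decoder mapping $Y^n$ to $\hat M\in\mathcal{M}$; and a (possibly stochastic) state estimator mapping $(X^n,S_e^n,Z^n)$ to $\hat S^n\in\hat{\mathcal{S}}^n$. $(R,0)$ is $(D,0)$-achievable without common randomness if for every $\epsilon>0$ and all sufficiently large $n$ there is such a code with $\Pr\{M\neq\hat M\}\le\epsilon$, $\mathbb{E}[d(S^n,\hat S^n)]\le D$ and $P_{\hat S^n}=P_S^n:=\prod_{i=1}^nP_S$. The distribution-preserving capacity-distortion region without common randomness (at distortion $D$ and perfect distribution preservation) is the set of $(R,0)$ such that $(R,D)$ lies in the closure of the set of $(R',D')$ for which $(R',0)$ is $(D',0)$-achievable without common randomness. $\mathcal{P}_{NCR}^{DE}$ is the set of joint distributions of the form $$P_{XS_eS_e'YZ\hat S}=P_{S_eS_e'}\,P_{X|S_e}\,\mathbb{I}\{Y=y(X,S_e)\}\,P_{Z|XS_eS_e'}\,P_{\hat S|XS_eZ}$$ with $P_{\hat S}=P_S$. *)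

theory Defs
  imports "HOL-Probability.Probability"
begin

text \<open>
  Length-\<open>n\<close> sequences are functions on \<open>{..<n}\<close> that are \<open>undefined\<close> elsewhere, so that an index
  outside \<open>{..<n}\<close> cannot carry information. This agrees with \<open>Pi_pmf {..<n} undefined\<close>.
\<close>

definition seqs :: "nat \<Rightarrow> (nat \<Rightarrow> 'a) set" where
  "seqs n = {..<n} \<rightarrow>\<^sub>E UNIV"

definition iid :: "nat \<Rightarrow> 'a pmf \<Rightarrow> (nat \<Rightarrow> 'a) pmf" where
  "iid n P = Pi_pmf {..<n} undefined (\<lambda>_. P)"

definition seq_map :: "nat \<Rightarrow> ('a \<Rightarrow> 'b) \<Rightarrow> (nat \<Rightarrow> 'a) \<Rightarrow> (nat \<Rightarrow> 'b)" where
  "seq_map n f a = (\<lambda>i\<in>{..<n}. f (a i))"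

definition memoryless ::
    "nat \<Rightarrow> ('x \<Rightarrow> 's \<Rightarrow> 'o pmf) \<Rightarrow> (nat \<Rightarrow> 'x) \<Rightarrow> (nat \<Rightarrow> 's) \<Rightarrow> (nat \<Rightarrow> 'o) pmf" where
  "memoryless n W x s = Pi_pmf {..<n} undefined (\<lambda>i. W (x i) (s i))"

definition avg_distortion ::
    "nat \<Rightarrow> ('s \<Rightarrow> 's \<Rightarrow> real) \<Rightarrow> (nat \<Rightarrow> 's) \<Rightarrow> (nat \<Rightarrow> 's) \<Rightarrow> real" where
  "avg_distortion n d s t = (1 / real n) * (\<Sum>i<n. d (s i) (t i))"

definition messages :: "nat \<Rightarrow> real \<Rightarrow> nat set" where
  "messages n R = {m. 1 \<le> m \<and> real m \<le> 2 powr (real n * R)}"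

text \<open>
  The encoder and the estimator are stochastic kernels whose randomness is local: nothing is shared
  between them, nor with the decoder. A code needs at least one message, which rules out negative
  rates for \<open>n \<ge> 1\<close>.
\<close>

definition is_code ::
    "nat \<Rightarrow> real \<Rightarrow> (nat \<Rightarrow> (nat \<Rightarrow> 'e) \<Rightarrow> (nat \<Rightarrow> 'x) pmf) \<Rightarrow> ((nat \<Rightarrow> 'y) \<Rightarrow> nat) \<Rightarrow>
     ((nat \<Rightarrow> 'x) \<Rightarrow> (nat \<Rightarrow> 'e) \<Rightarrow> (nat \<Rightarrow> 'z) \<Rightarrow> (nat \<Rightarrow> 'e \<times> 'f) pmf) \<Rightarrow> bool" where
  "is_code n R enc dec est \<longleftrightarrow>
     messages n R \<noteq> {} \<and>
     (\<forall>m\<in>messages n R. \<forall>se\<in>seqs n. set_pmf (enc m se) \<subseteq> seqs n) \<and>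
     (\<forall>v\<in>seqs n. dec v \<in> messages n R) \<and>
     (\<forall>x\<in>seqs n. \<forall>se\<in>seqs n. \<forall>z\<in>seqs n. set_pmf (est x se z) \<subseteq> seqs n)"

text \<open>The joint law of message, decoded message, state sequence and estimated state sequence.\<close>

definition code_law ::
    "('e \<times> 'f) pmf \<Rightarrow> ('x \<Rightarrow> 'e \<times> 'f \<Rightarrow> ('y \<times> 'z) pmf) \<Rightarrow> nat \<Rightarrow> real \<Rightarrow>
     (nat \<Rightarrow> (nat \<Rightarrow> 'e) \<Rightarrow> (nat \<Rightarrow> 'x) pmf) \<Rightarrow> ((nat \<Rightarrow> 'y) \<Rightarrow> nat) \<Rightarrow>
     ((nat \<Rightarrow> 'x) \<Rightarrow> (nat \<Rightarrow> 'e) \<Rightarrow> (nat \<Rightarrow> 'z) \<Rightarrow> (nat \<Rightarrow> 'e \<times> 'f) pmf) \<Rightarrow>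
     (nat \<times> nat \<times> (nat \<Rightarrow> 'e \<times> 'f) \<times> (nat \<Rightarrow> 'e \<times> 'f)) pmf" where
  "code_law P W n R enc dec est =
     do {
       m \<leftarrow> pmf_of_set (messages n R);
       s \<leftarrow> iid n P;
       x \<leftarrow> enc m (seq_map n fst s);
       out \<leftarrow> memoryless n W x s;
       t \<leftarrow> est x (seq_map n fst s) (seq_map n snd out);
       return_pmf (m, dec (seq_map n fst out), s, t)
     }"

definition achievable ::
    "('e \<times> 'f) pmf \<Rightarrow> ('x \<Rightarrow> 'e \<times> 'f \<Rightarrow> ('y \<times> 'z) pmf) \<Rightarrow>
     ('e \<times> 'f \<Rightarrow> 'e \<times> 'f \<Rightarrow> real) \<Rightarrow> real \<Rightarrow> real \<Rightarrow> bool" where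
  "achievable P W d R D \<longleftrightarrow>
     (\<forall>\<epsilon>>0. \<forall>\<^sub>F n in sequentially. \<exists>enc dec est.
        is_code n R enc dec est \<and>
        (let Q = code_law P W n R enc dec est in
           measure_pmf.prob Q {(m, m', s, t). m \<noteq> m'} \<le> \<epsilon> \<and>
           measure_pmf.expectation Q (\<lambda>(m, m', s, t). avg_distortion n d s t) \<le> D \<and>
           map_pmf (\<lambda>(m, m', s, t). t) Q = iid n P))"

text \<open>
  The second coordinate is the common randomness rate, which is zero throughout. The closure is
  taken jointly in rate and distortion.
\<close>

definition C_NCR ::
    "('e \<times> 'f) pmf \<Rightarrow> ('x \<Rightarrow> 'e \<times> 'f \<Rightarrow> ('y \<times> 'z) pmf) \<Rightarrow>
     ('e \<times> 'f \<Rightarrow> 'e \<times> 'f \<Rightarrow> real) \<Rightarrow> real \<Rightarrow> (real \<times> real) set" where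
  "C_NCR P W d D = {(R, 0) | R. (R, D) \<in> closure {(R', D'). achievable P W d R' D'}}"

text \<open>Joint distributions of \<open>(X, S\<^sub>e, S\<^sub>e', Y, Z, S_hat)\<close>, with \<open>S_hat\<close> ranging over pairs.\<close>

definition P_NCR_DE ::
    "('e \<times> 'f) pmf \<Rightarrow> ('x \<Rightarrow> 'e \<Rightarrow> 'y) \<Rightarrow> ('x \<Rightarrow> 'e \<Rightarrow> 'f \<Rightarrow> 'z pmf) \<Rightarrow>
     ('x \<times> 'e \<times> 'f \<times> 'y \<times> 'z \<times> ('e \<times> 'f)) pmf set" where
  "P_NCR_DE P y PZ =
     {J. (\<exists>(PX :: 'e \<Rightarrow> 'x pmf) (PT :: 'x \<Rightarrow> 'e \<Rightarrow> 'z \<Rightarrow> ('e \<times> 'f) pmf).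
            \<forall>x se sf v z t. pmf J (x, se, sf, v, z, t) =
              pmf P (se, sf) * pmf (PX se) x * of_bool (v = y x se) *
              pmf (PZ x se sf) z * pmf (PT x se z) t) \<and>
         map_pmf (\<lambda>(x, se, sf, v, z, t). t) J = P}"

definition cond_entropy :: "'a pmf \<Rightarrow> ('a \<Rightarrow> 'b) \<Rightarrow> ('a \<Rightarrow> 'c) \<Rightarrow> real" where
  "cond_entropy J A B =
     prob_space.conditional_entropy (measure_pmf J) 2 (count_space (range A)) (count_space (range B)) A B"

end

theory Submission
  imports Defs "HOL-Real_Asymp.Real_Asymp"
begin

text \<open>
  Achievability: if \<open>R < H(Y|S\<^sub>e)\<close>, then for a random map \<open>h\<close> from output sequences to messages,
  \<open>h(Y\<^sup>n)\<close> is nearly uniform given \<open>S\<^sub>e\<^sup>n\<close> (a second-moment bound on the typical part of the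
  conditional law). The encoder couples the message maximally with \<open>h(Y\<^sup>n)\<close> and then draws \<open>X\<^sup>n\<close>
  conditionally on \<open>h(Y\<^sup>n)\<close>, so that \<open>X\<^sup>n\<close> is exactly memoryless given \<open>S\<^sub>e\<^sup>n\<close>: the letterwise
  estimator then has exactly the law \<open>P\<^sub>S\<^sup>n\<close> and exactly the single-letter distortion. An error only
  occurs when the coupling fails.

  Converse: the average of the laws of the \<open>n\<close> letters of a code is an admissible single-letter law,
  because given \<open>(X\<^sub>i, S\<^sub>e\<^sub>,\<^sub>i, Z\<^sub>i)\<close> the estimate does not depend on \<open>S'\<^sub>e\<^sub>,\<^sub>i\<close>. One application of
  Gibbs' inequality bounds the rate by its output entropy, and compactness of the set of kernels
  handles the closure.
\<close>

section \<open>Finitely supported probability mass functions\<close>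

text \<open>The estimates must have the law of \<open>iid n P\<close> exactly, while decoding may
  fail with small probability. A random codebook would make the input only approximately memoryless
  and spoil the exact constraint; here all approximation sits in the event that the message differs
  from the hash of the output. The decoder is the hash itself, so one function must be good on
  average over states that it does not see. Determinism of the channel makes this possible: once the
  encoder knows its states, prescribing the hash of the output is a condition on the input alone.

  In the converse, the estimate of a letter may depend on the whole block. The average over letters
  is therefore taken first, with the feedback letter held fixed, and only the average is factored
  into an input kernel and an estimator kernel. The reference law in the entropy bound is the output
  law of this averaged input kernel, and that choice accounts for the concavity of entropy.\<close>

lemma expectation_bind_pmf:
  fixes h :: "'b \<Rightarrow> real"
  assumes "finite (set_pmf p)" "\<And>x. x \<in> set_pmf p \<Longrightarrow> finite (set_pmf (f x))"
  shows "measure_pmf.expectation (bind_pmf p f) h =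
         measure_pmf.expectation p (\<lambda>x. measure_pmf.expectation (f x) h)"
  using assms by (subst pmf_expectation_bind[of "set_pmf p"])
    (auto simp: integral_measure_pmf[of "set_pmf p"])

lemma expectation_mono_pmf:
  fixes f g :: "'a \<Rightarrow> real"
  assumes "finite (set_pmf p)" "\<And>x. x \<in> set_pmf p \<Longrightarrow> f x \<le> g x"
  shows "measure_pmf.expectation p f \<le> measure_pmf.expectation p g"
  using assms by (intro integral_mono_AE integrable_measure_pmf_finite AE_pmfI)

lemma prob_eq_expectation: "measure_pmf.prob p A = measure_pmf.expectation p (\<lambda>x. of_bool (x \<in> A))"
proof -
  have "measure_pmf.prob p A = measure_pmf.expectation p (indicator A)"
    by simp
  also have "indicator A = (\<lambda>x. of_bool (x \<in> A) :: real)"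
    by (auto simp: indicator_def)
  finally show ?thesis .
qed

lemma pmf_bind_finite:
  fixes p :: "'a::finite pmf"
  shows "pmf (bind_pmf p f) b = (\<Sum>a\<in>UNIV. pmf p a * pmf (f a) b)"
  by (simp add: pmf_bind integral_measure_pmf[of UNIV])

lemma sum_pmf_UNIV: "(\<Sum>a\<in>UNIV. pmf (p :: 'a::finite pmf) a) = 1"
  by (simp add: sum_pmf_eq_1)

lemma pmf_disintegration:
  obtains k where "\<And>a b. pmf p (a, b) = pmf (map_pmf fst p) a * pmf (k a) b"
proof -
  \<comment> \<open>Off the support of the first marginal \<open>cond_pmf\<close> is unspecified;
    both sides of the factorization vanish there, so \<open>k\<close> can be a total
    function.\<close>
  define k where "k a = map_pmf snd (cond_pmf p {w. fst w = a})" for a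
  have "pmf p (a, b) = pmf (map_pmf fst p) a * pmf (k a) b" for a b
  proof (cases "a \<in> set_pmf (map_pmf fst p)")
    case True
    hence ne: "set_pmf p \<inter> {w. fst w = a} \<noteq> {}" by auto
    have "pmf (k a) b = pmf (cond_pmf p {w. fst w = a}) (a, b)"
    proof -
      have "pmf (k a) b = measure_pmf.prob (cond_pmf p {w. fst w = a}) (snd -` {b})"
        by (simp add: k_def pmf_map)
      also have "\<dots> = measure_pmf.prob (cond_pmf p {w. fst w = a}) {(a, b)}"
        using ne by (intro measure_prob_cong_0) (auto simp: pmf_cond)
      finally show ?thesis by (simp add: measure_pmf_single)
    qed
    also have "\<dots> = pmf p (a, b) / measure_pmf.prob p {w. fst w = a}"
      using ne by (simp add: pmf_cond)
    also have "measure_pmf.prob p {w. fst w = a} = pmf (map_pmf fst p) a"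
      by (auto simp: pmf_map vimage_def)
    moreover have "pmf (map_pmf fst p) a \<noteq> 0"
      using True unfolding set_pmf_iff .
    ultimately show ?thesis
      by (metis nonzero_eq_divide_eq mult.commute)
  next
    case False
    hence "(a, b) \<notin> set_pmf p" by force
    with False show ?thesis by (simp only: set_pmf_iff) simp
  qed
  thus ?thesis using that by blast
qed

lemma pmf_map_Pair: "pmf (map_pmf (Pair c) p) (a, b) = of_bool (c = a) * pmf p b"
proof (cases "c = a")
  case True
  thus ?thesis by (simp add: pmf_map_inj' inj_def)
next
  case False
  hence "(a, b) \<notin> set_pmf (map_pmf (Pair c) p)" by auto
  thus ?thesis using False unfolding set_pmf_iff by simp
qed

lemma pmf_bind_map_Pair:
  "pmf (bind_pmf p (\<lambda>a. map_pmf (Pair a) (k a))) (a, b) = pmf p a * pmf (k a) b"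
proof -
  have "pmf (map_pmf (Pair c) (k c)) (a, b) = indicator {a} c * pmf (k a) b" for c
    by (simp add: pmf_map_Pair indicator_def)
  thus ?thesis
    by (simp add: pmf_bind measure_pmf_single)
qed

lemma pmf_disintegration_bind:
  obtains k where "p = bind_pmf (map_pmf fst p) (\<lambda>a. map_pmf (Pair a) (k a))"
proof -
  obtain k where k: "\<And>a b. pmf p (a, b) = pmf (map_pmf fst p) a * pmf (k a) b"
    using pmf_disintegration by blast
  have "p = bind_pmf (map_pmf fst p) (\<lambda>a. map_pmf (Pair a) (k a))"
    by (intro pmf_eqI) (auto simp: pmf_bind_map_Pair k split_paired_all)
  thus ?thesis using that by blast
qed

section \<open>Total variation and maximal coupling\<close>

definition total_variation :: "'a set \<Rightarrow> 'a pmf \<Rightarrow> 'a pmf \<Rightarrow> real" where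
  "total_variation A p q = (\<Sum>a\<in>A. max 0 (pmf p a - pmf q a))"

lemma total_variation_le_l1:
  "total_variation A p q \<le> (\<Sum>a\<in>A. \<bar>pmf p a - pmf q a\<bar>)"
  unfolding total_variation_def by (intro sum_mono) auto

text \<open>The common mass \<open>min (pmf p a) (pmf q a)\<close> stays on the diagonal, and the
  two excesses, each of total \<open>\<tau>\<close>, are coupled independently. For laws carried by
  \<open>A\<close>, \<open>\<tau>\<close> is half the l1 distance.\<close>

lemma maximal_coupling:
  assumes A: "finite A" "set_pmf p \<subseteq> A" "set_pmf q \<subseteq> A"
  obtains r where "map_pmf fst r = p" "map_pmf snd r = q"
    "measure_pmf.prob r {(a, b). a \<noteq> b} \<le> total_variation A p q"
proof -
  define \<tau> where "\<tau> = total_variation A p q"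
  define mn where "mn a = min (pmf p a) (pmf q a)" for a
  define g where "g w = (case w of (a, b) \<Rightarrow>
    of_bool (a = b) * mn a + (pmf p a - mn a) * (pmf q b - mn b) / \<tau>)" for w
  have p0: "pmf p a = 0" if "a \<notin> A" for a using that A by (auto simp: set_pmf_iff)
  have q0: "pmf q a = 0" if "a \<notin> A" for a using that A by (auto simp: set_pmf_iff)
  have mn0: "mn a = 0" if "a \<notin> A" for a using that p0 by (simp add: mn_def)
  have mnp: "mn a \<le> pmf p a" "mn a \<le> pmf q a" "0 \<le> mn a" for a by (auto simp: mn_def)
  have tp: "(\<Sum>a\<in>A. pmf p a - mn a) = \<tau>"
    unfolding \<tau>_def total_variation_def by (intro sum.cong) (auto simp: mn_def)
  have sp: "(\<Sum>a\<in>A. pmf p a) = 1" "(\<Sum>a\<in>A. pmf q a) = 1"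
    using A by (auto intro: sum_pmf_eq_1)
  have tq: "(\<Sum>a\<in>A. pmf q a - mn a) = \<tau>"
    using tp by (simp add: sum_subtractf sp)
  have tau0: "0 \<le> \<tau>" unfolding \<tau>_def total_variation_def by (intro sum_nonneg) auto
  \<comment> \<open>If \<open>\<tau> = 0\<close>, both excesses vanish on \<open>A\<close>, in
    agreement with the value 0 of the division by \<open>\<tau>\<close> in \<open>g\<close>.\<close>
  have zp: "pmf p a - mn a = 0" if "\<tau> = 0" "a \<in> A" for a
    using tp that A(1) mnp by (subst (asm) that(1), subst (asm) sum_nonneg_eq_0_iff) auto
  have zq: "pmf q a - mn a = 0" if "\<tau> = 0" "a \<in> A" for a
    using tq that A(1) mnp by (subst (asm) that(1), subst (asm) sum_nonneg_eq_0_iff) auto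
  have gnn: "0 \<le> g w" for w
    using mnp tau0 by (auto simp: g_def split: prod.split intro!: add_nonneg_nonneg mult_nonneg_nonneg divide_nonneg_nonneg)
  have row: "(\<Sum>b\<in>A. g (a, b)) = pmf p a" if "a \<in> A" for a
  proof -
    have "(\<Sum>b\<in>A. g (a, b)) = (\<Sum>b\<in>A. of_bool (a = b) * mn a) + (pmf p a - mn a) * (\<Sum>b\<in>A. pmf q b - mn b) / \<tau>"
      by (simp add: g_def sum.distrib sum_distrib_left sum_divide_distrib)
    also have "(\<Sum>b\<in>A. of_bool (a = b) * mn a) = mn a"
      using A(1) that by (subst sum.remove[of _ a]) auto
    finally show ?thesis using zp[OF _ that] tq by (cases "\<tau> = 0") auto
  qed
  have col: "(\<Sum>a\<in>A. g (a, b)) = pmf q b" if "b \<in> A" for b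
  proof -
    have "(\<Sum>a\<in>A. g (a, b)) = (\<Sum>a\<in>A. of_bool (a = b) * mn a) + (\<Sum>a\<in>A. pmf p a - mn a) * (pmf q b - mn b) / \<tau>"
      by (simp add: g_def sum.distrib sum_distrib_right sum_divide_distrib)
    also have "(\<Sum>a\<in>A. of_bool (a = b) * mn a) = mn b"
      using A(1) that by (subst sum.remove[of _ b]) auto
    finally show ?thesis using zq[OF _ that] tp by (cases "\<tau> = 0") auto
  qed
  have g0: "g w = 0" if "w \<notin> A \<times> A" for w
  proof (cases w)
    case (Pair a b)
    with that consider "a \<notin> A" | "b \<notin> A" by auto
    thus ?thesis using p0 q0 mn0 by cases (auto simp: g_def Pair)
  qed
  have gsum: "(\<Sum>w\<in>A\<times>A. g w) = 1"
    using row sp by (simp add: sum.cartesian_product')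
  have nn: "(\<integral>\<^sup>+ w. ennreal (g w) \<partial>count_space UNIV) = 1"
  proof -
    have "(\<integral>\<^sup>+ w. ennreal (g w) \<partial>count_space UNIV) = (\<Sum>w\<in>A\<times>A. ennreal (g w))"
      using g0 A(1) by (intro nn_integral_count_space') auto
    also have "\<dots> = ennreal (\<Sum>w\<in>A\<times>A. g w)" using gnn by simp
    finally show ?thesis using gsum by simp
  qed
  define r where "r = embed_pmf g"
  have pr: "pmf r w = g w" for w
    unfolding r_def using gnn nn by (subst pmf_embed_pmf) auto
  have setr: "set_pmf r \<subseteq> A \<times> A"
    using g0 unfolding set_pmf_iff pr subset_iff mem_Collect_eq by blast
  have "pmf (map_pmf fst r) a = pmf p a" for a
  proof -
    have "pmf (map_pmf fst r) a = measure_pmf.prob r ({a} \<times> A)"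
      unfolding pmf_map using setr
      by (intro measure_prob_cong_0) (auto simp: pr intro!: g0)
    also have "\<dots> = (\<Sum>w\<in>{a}\<times>A. g w)"
      using A by (simp add: measure_measure_pmf_finite pr)
    also have "\<dots> = (\<Sum>b\<in>A. g (a, b))" by (simp add: sum.cartesian_product')
    finally show ?thesis using row[of a] g0 p0 by (cases "a \<in> A") auto
  qed
  moreover have "pmf (map_pmf snd r) b = pmf q b" for b
  proof -
    have "pmf (map_pmf snd r) b = measure_pmf.prob r (A \<times> {b})"
      unfolding pmf_map using setr
      by (intro measure_prob_cong_0) (auto simp: pr intro!: g0)
    also have "\<dots> = (\<Sum>w\<in>A\<times>{b}. g w)"
      using A by (simp add: measure_measure_pmf_finite pr)
    also have "\<dots> = (\<Sum>a\<in>A. g (a, b))" by (simp add: sum.cartesian_product')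
    finally show ?thesis using col[of b] g0 q0 by (cases "b \<in> A") auto
  qed
  moreover have "measure_pmf.prob r {(a, b). a \<noteq> b} \<le> total_variation A p q"
  proof -
    have "1 - \<tau> = (\<Sum>a\<in>A. mn a)" using tp sp by (simp add: sum_subtractf)
    also have "\<dots> \<le> (\<Sum>a\<in>A. g (a, a))"
      using mnp tau0 by (intro sum_mono) (auto simp: g_def)
    also have "\<dots> = (\<Sum>w\<in>(\<lambda>a. (a, a)) ` A. g w)"
      by (subst sum.reindex) (auto simp: inj_on_def)
    also have "\<dots> = measure_pmf.prob r ((\<lambda>a. (a, a)) ` A)"
      using A(1) by (simp add: measure_measure_pmf_finite pr)
    also have "\<dots> \<le> measure_pmf.prob r (- {(a, b). a \<noteq> b})"
      by (intro measure_pmf.finite_measure_mono) auto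
    also have "\<dots> = 1 - measure_pmf.prob r {(a, b). a \<noteq> b}"
      by (simp add: measure_pmf.prob_compl Compl_eq_Diff_UNIV measure_pmf.prob_compl[of _ r, simplified])
    finally show ?thesis by (simp add: \<tau>_def)
  qed
  ultimately show ?thesis using that[of r] by (auto intro: pmf_eqI)
qed

section \<open>Single-letter laws\<close>

lemma sum_UNIV_single:
  fixes g :: "'a::finite \<Rightarrow> real"
  assumes "\<And>a. a \<noteq> c \<Longrightarrow> g a = 0"
  shows "(\<Sum>a\<in>UNIV. g a) = g c"
  using assms by (subst sum.remove[of _ c]) auto

text \<open>Parametrizing the admissible laws by the two free kernels \<open>PX\<close> and
  \<open>PT\<close> keeps source and channel fixed in every construction and in every limit.\<close>

definition joint_law ::
    "('e \<times> 'f) pmf \<Rightarrow> ('x \<Rightarrow> 'e \<Rightarrow> 'y) \<Rightarrow> ('x \<Rightarrow> 'e \<Rightarrow> 'f \<Rightarrow> 'z pmf) \<Rightarrow>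
     ('e \<Rightarrow> 'x pmf) \<Rightarrow> ('x \<Rightarrow> 'e \<Rightarrow> 'z \<Rightarrow> ('e \<times> 'f) pmf) \<Rightarrow>
     ('x \<times> 'e \<times> 'f \<times> 'y \<times> 'z \<times> ('e \<times> 'f)) pmf" where
  "joint_law P y PZ PX PT =
     do {
       s \<leftarrow> P;
       x \<leftarrow> PX (fst s);
       z \<leftarrow> PZ x (fst s) (snd s);
       t \<leftarrow> PT x (fst s) z;
       return_pmf (x, fst s, snd s, y x (fst s), z, t)
     }"

lemma pmf_joint_law:
  fixes P :: "('e::finite \<times> 'f::finite) pmf" and PZ :: "'x::finite \<Rightarrow> 'e \<Rightarrow> 'f \<Rightarrow> 'z::finite pmf"
  shows "pmf (joint_law P y PZ PX PT) (x, se, sf, v, z, t) =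
    pmf P (se, sf) * pmf (PX se) x * of_bool (v = y x se) * pmf (PZ x se sf) z * pmf (PT x se z) t"
  unfolding joint_law_def pmf_bind_finite
  by (subst sum_UNIV_single[where c = "(se, sf)"], (auto intro!: sum.neutral simp: indicator_def)[1],
      subst sum_UNIV_single[where c = x], (auto intro!: sum.neutral simp: indicator_def)[1],
      subst sum_UNIV_single[where c = z], (auto intro!: sum.neutral simp: indicator_def)[1],
      subst sum_UNIV_single[where c = t], (auto simp: indicator_def)[1], simp add: indicator_def)

text \<open>A pmf is determined by its values, and the required factorization prescribes all of
  them.\<close>

lemma P_NCR_DE_eq:
  fixes P :: "('e::finite \<times> 'f::finite) pmf" and PZ :: "'x::finite \<Rightarrow> 'e \<Rightarrow> 'f \<Rightarrow> 'z::finite pmf"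
    and y :: "'x \<Rightarrow> 'e \<Rightarrow> 'y"
  shows "P_NCR_DE P y PZ = {joint_law P y PZ PX PT | PX PT.
           map_pmf (\<lambda>(x, se, sf, v, z, t). t) (joint_law P y PZ PX PT) = P}"
    (is "?A = ?B")
proof (intro equalityI subsetI)
  fix J assume "J \<in> ?A"
  then obtain PX PT where J: "\<And>x se sf v z t. pmf J (x, se, sf, v, z, t) =
              pmf P (se, sf) * pmf (PX se) x * of_bool (v = y x se) *
              pmf (PZ x se sf) z * pmf (PT x se z) t"
    and m: "map_pmf (\<lambda>(x, se, sf, v, z, t). t) J = P"
    unfolding P_NCR_DE_def by blast
  have "J = joint_law P y PZ PX PT"
  proof (rule pmf_eqI)
    fix w :: "'x \<times> 'e \<times> 'f \<times> 'y \<times> 'z \<times> 'e \<times> 'f"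
    obtain x se sf v z t where w: "w = (x, se, sf, v, z, t)" by (cases w) auto
    show "pmf J w = pmf (joint_law P y PZ PX PT) w"
      unfolding w J pmf_joint_law ..
  qed
  with m show "J \<in> ?B" by (intro CollectI exI[of _ PX] exI[of _ PT]) simp
next
  fix J assume "J \<in> ?B"
  then obtain PX PT where J: "J = joint_law P y PZ PX PT"
    "map_pmf (\<lambda>(x, se, sf, v, z, t). t) J = P" by blast
  show "J \<in> ?A"
    unfolding P_NCR_DE_def
    by (intro CollectI conjI exI[of _ PX] exI[of _ PT] allI J(2)) (simp add: J(1) pmf_joint_law)
qed

definition output_law :: "('x \<Rightarrow> 'e \<Rightarrow> 'y) \<Rightarrow> ('e \<Rightarrow> 'x pmf) \<Rightarrow> 'e \<Rightarrow> 'y pmf" where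
  "output_law y PX e = map_pmf (\<lambda>x. y x e) (PX e)"

text \<open>This is \<open>H(Y|S_e)\<close> in bits. A value of probability 0 contributes 0 because
  the factor in front of the logarithm vanishes.\<close>

definition output_entropy ::
    "('e::finite \<times> 'f) pmf \<Rightarrow> ('x \<Rightarrow> 'e \<Rightarrow> 'y::finite) \<Rightarrow> ('e \<Rightarrow> 'x pmf) \<Rightarrow> real" where
  "output_entropy P y PX =
     (\<Sum>e\<in>UNIV. \<Sum>v\<in>UNIV. pmf (map_pmf fst P) e *
        (pmf (output_law y PX e) v * - log 2 (pmf (output_law y PX e) v)))"

text \<open>The library formula sums over the image of the sample space. Pairs outside it have mass
  0, so the sum may run over the whole type.\<close>

lemma cond_entropy_eq_sum:
  fixes A :: "'a \<Rightarrow> 'b::finite" and B :: "'a \<Rightarrow> 'c::finite"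
  shows "cond_entropy J A B =
    - (\<Sum>(a, b)\<in>UNIV. pmf (map_pmf (\<lambda>w. (A w, B w)) J) (a, b) *
         log 2 (pmf (map_pmf (\<lambda>w. (A w, B w)) J) (a, b) / pmf (map_pmf B J) b))"
proof -
  interpret information_space "measure_pmf J" 2
    by unfold_locales simp
  have sf: "simple_function (measure_pmf J) f" for f :: "'a \<Rightarrow> 'd::finite"
    by (simp add: simple_function_def)
  let ?Pxy = "\<lambda>w. pmf (map_pmf (\<lambda>w. (A w, B w)) J) w"
  let ?Py = "\<lambda>b. pmf (map_pmf B J) b"
  have "cond_entropy J A B =
    - (\<Sum>(x, y)\<in>(\<lambda>x. (A x, B x)) ` space (measure_pmf J). ?Pxy (x, y) * log 2 (?Pxy (x, y) / ?Py y))"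
    unfolding cond_entropy_def
    using conditional_entropy_eq[of B ?Py A ?Pxy]
    by (simp add: measure_pmf.simple_distributedI[OF sf] pmf_map)
  also have "(\<Sum>(x, y)\<in>(\<lambda>x. (A x, B x)) ` space (measure_pmf J). ?Pxy (x, y) * log 2 (?Pxy (x, y) / ?Py y))
     = (\<Sum>(x, y)\<in>UNIV. ?Pxy (x, y) * log 2 (?Pxy (x, y) / ?Py y))"
  proof (intro sum.mono_neutral_left ballI)
    fix w assume w: "w \<in> UNIV - (\<lambda>x. (A x, B x)) ` space (measure_pmf J)"
    obtain a b where ab: "w = (a, b)" by (cases w) auto
    have "(a, b) \<notin> set_pmf (map_pmf (\<lambda>w. (A w, B w)) J)" using w ab by auto
    hence "?Pxy (a, b) = 0" by (simp only: set_pmf_iff) simp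
    thus "(case w of (x, y) \<Rightarrow> ?Pxy (x, y) * log 2 (?Pxy (x, y) / ?Py y)) = 0"
      by (simp add: ab)
  qed auto
  finally show ?thesis .
qed

lemma cond_entropy_joint_law:
  fixes P :: "('e::finite \<times> 'f::finite) pmf" and PZ :: "'x::finite \<Rightarrow> 'e \<Rightarrow> 'f \<Rightarrow> 'z::finite pmf"
    and y :: "'x \<Rightarrow> 'e \<Rightarrow> 'y::finite"
  shows "cond_entropy (joint_law P y PZ PX PT)
           (\<lambda>(x, se, sf, v, z, t). v) (\<lambda>(x, se, sf, v, z, t). se) = output_entropy P y PX"
proof -
  let ?J = "joint_law P y PZ PX PT"
  have se: "map_pmf (\<lambda>(x, se, sf, v, z, t). se) ?J = map_pmf fst P"
    by (simp add: joint_law_def map_pmf_def bind_assoc_pmf bind_return_pmf)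
  have vse: "map_pmf (\<lambda>w. (case w of (x, se, sf, v, z, t) \<Rightarrow> v, case w of (x, se, sf, v, z, t) \<Rightarrow> se)) ?J =
     bind_pmf (map_pmf fst P) (\<lambda>e. map_pmf (\<lambda>v. (v, e)) (output_law y PX e))"
    by (simp add: joint_law_def output_law_def map_pmf_def bind_assoc_pmf bind_return_pmf)
  have p: "pmf (bind_pmf (map_pmf fst P) (\<lambda>e. map_pmf (\<lambda>v. (v, e)) (output_law y PX e))) (v, e) =
     pmf (map_pmf fst P) e * pmf (output_law y PX e) v" for v e
    unfolding pmf_bind_finite map_pmf_def[of "\<lambda>v. (v, _)"]
    by (subst sum_UNIV_single[where c = e], (auto intro!: sum.neutral)[1],
        subst sum_UNIV_single[where c = v]) auto
  have "cond_entropy ?J (\<lambda>(x, se, sf, v, z, t). v) (\<lambda>(x, se, sf, v, z, t). se) =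
    - (\<Sum>(v, e)\<in>UNIV \<times> UNIV. pmf (map_pmf fst P) e * pmf (output_law y PX e) v *
       log 2 (pmf (map_pmf fst P) e * pmf (output_law y PX e) v / pmf (map_pmf fst P) e))"
    unfolding cond_entropy_eq_sum se vse p by simp
  \<comment> \<open>Where the mass of \<open>e\<close> is 0 both summands vanish; elsewhere it
    cancels in the quotient.\<close>
  also have "\<dots> = (\<Sum>v\<in>UNIV. \<Sum>e\<in>UNIV. pmf (map_pmf fst P) e *
        (pmf (output_law y PX e) v * - log 2 (pmf (output_law y PX e) v)))"
    unfolding sum.cartesian_product' sum_negf[symmetric]
    by (intro sum.cong refl) auto
  also have "\<dots> = output_entropy P y PX"
    unfolding output_entropy_def by (rule sum.swap)
  finally show ?thesis .
qed

section \<open>Random hashing\<close>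

lemma finite_set_Pi_pmf:
  assumes "finite A" "\<And>i. i \<in> A \<Longrightarrow> finite (set_pmf (p i))"
  shows "finite (set_pmf (Pi_pmf A dflt p))"
  using assms by (auto simp: set_Pi_pmf)

lemma expectation_Pi_pmf_component:
  fixes g :: "'a \<Rightarrow> real"
  assumes "finite A" "i \<in> A"
  shows "measure_pmf.expectation (Pi_pmf A dflt p) (\<lambda>w. g (w i)) = measure_pmf.expectation (p i) g"
proof -
  have "measure_pmf.expectation (Pi_pmf A dflt p) (\<lambda>w. g (w i)) =
        measure_pmf.expectation (map_pmf (\<lambda>w. w i) (Pi_pmf A dflt p)) g"
    by simp
  thus ?thesis using assms by (simp only: Pi_pmf_component) simp
qed

lemma expectation_sum_finite:
  fixes f :: "'i \<Rightarrow> 'a \<Rightarrow> real"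
  assumes "finite (set_pmf p)"
  shows "measure_pmf.expectation p (\<lambda>w. \<Sum>i\<in>A. f i w) = (\<Sum>i\<in>A. measure_pmf.expectation p (f i))"
  using assms by (intro Bochner_Integration.integral_sum integrable_measure_pmf_finite)

text \<open>When one coordinate is split off, the cross term \<open>2 * f j b * S w\<close> has mean
  0. The identity serves both the random hash and Chebyshev's inequality.\<close>

lemma expectation_square_sum_Pi_pmf:
  fixes f :: "'i \<Rightarrow> 'a \<Rightarrow> real"
  assumes "finite A" "\<And>i. i \<in> A \<Longrightarrow> finite (set_pmf (p i))"
    and "\<And>i. i \<in> A \<Longrightarrow> measure_pmf.expectation (p i) (f i) = 0"
  shows "measure_pmf.expectation (Pi_pmf A dflt p) (\<lambda>w. (\<Sum>i\<in>A. f i (w i))\<^sup>2) =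
         (\<Sum>i\<in>A. measure_pmf.expectation (p i) (\<lambda>a. (f i a)\<^sup>2))"
  using assms
proof (induction A rule: finite_induct)
  case empty
  show ?case by simp
next
  case (insert j A)
  let ?Q = "Pi_pmf A dflt p"
  define S where "S w = (\<Sum>i\<in>A. f i (w i))" for w
  have fin: "finite (set_pmf ?Q)" "finite (set_pmf (p j))"
    using insert by (auto intro: finite_set_Pi_pmf)
  have S0: "measure_pmf.expectation ?Q S = 0"
    unfolding S_def using insert
    by (simp add: expectation_sum_finite[OF fin(1)] expectation_Pi_pmf_component)
  have upd: "(\<Sum>i\<in>insert j A. f i ((w(j := b)) i)) = f j b + S w" for w b
    using insert by (auto simp: S_def intro!: sum.cong)
  have int: "integrable (measure_pmf ?Q) g" "integrable (measure_pmf (p j)) g'"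
    for g :: "_ \<Rightarrow> real" and g' :: "_ \<Rightarrow> real"
    using fin by (auto intro: integrable_measure_pmf_finite)
  have inner: "measure_pmf.expectation ?Q (\<lambda>w. (f j b + S w)\<^sup>2) =
      (f j b)\<^sup>2 + measure_pmf.expectation ?Q (\<lambda>w. (S w)\<^sup>2)" for b
  proof -
    have "measure_pmf.expectation ?Q (\<lambda>w. (f j b + S w)\<^sup>2) =
          measure_pmf.expectation ?Q (\<lambda>w. (f j b)\<^sup>2 + 2 * f j b * S w + (S w)\<^sup>2)"
      by (simp add: power2_sum algebra_simps)
    also have "\<dots> = (f j b)\<^sup>2 + 2 * f j b * measure_pmf.expectation ?Q S +
        measure_pmf.expectation ?Q (\<lambda>w. (S w)\<^sup>2)"
      by (simp add: int)
    finally show ?thesis by (simp add: S0)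
  qed
  have "measure_pmf.expectation (Pi_pmf (insert j A) dflt p) (\<lambda>w. (\<Sum>i\<in>insert j A. f i (w i))\<^sup>2) =
    measure_pmf.expectation (pair_pmf (p j) ?Q) (\<lambda>(b, w). (f j b + S w)\<^sup>2)"
    by (simp only: Pi_pmf_insert[OF insert.hyps] integral_map_pmf case_prod_unfold upd)
  also have "\<dots> = measure_pmf.expectation (p j) (\<lambda>b. measure_pmf.expectation ?Q (\<lambda>w. (f j b + S w)\<^sup>2))"
    by (simp add: pair_pmf_def expectation_bind_pmf fin)
  also have "\<dots> = measure_pmf.expectation (p j) (\<lambda>b. (f j b)\<^sup>2) + measure_pmf.expectation ?Q (\<lambda>w. (S w)\<^sup>2)"
    by (simp add: inner int)
  also have "measure_pmf.expectation ?Q (\<lambda>w. (S w)\<^sup>2) = (\<Sum>i\<in>A. measure_pmf.expectation (p i) (\<lambda>a. (f i a)\<^sup>2))"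
    unfolding S_def using insert by auto
  finally show ?case using insert.hyps by simp
qed

text \<open>For fixed \<open>m\<close> the inner sum is centred over the hash, with variance at most
  the sum of the \<open>(a v)\<^sup>2\<close> divided by \<open>card M\<close>. The parameter
  \<open>\<epsilon>\<close> balances the two terms that arise when the absolute value is bounded by
  a square.\<close>

lemma random_hash_deviation:
  fixes a :: "'v \<Rightarrow> real" and M :: "'m set"
  assumes V: "finite V" and M: "finite M" "M \<noteq> {}" and \<epsilon>: "0 < \<epsilon>"
  shows "measure_pmf.expectation (Pi_pmf V dflt (\<lambda>_. pmf_of_set M))
      (\<lambda>h. \<Sum>m\<in>M. \<bar>\<Sum>v\<in>V. a v * (of_bool (h v = m) - 1 / card M)\<bar>)
    \<le> \<epsilon> / 2 + card M * (\<Sum>v\<in>V. (a v)\<^sup>2) / (2 * \<epsilon>)"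
proof -
  let ?H = "Pi_pmf V dflt (\<lambda>_. pmf_of_set M)"
  define K where "K = real (card M)"
  have K: "0 < K" using M by (auto simp: K_def card_gt_0_iff)
  define X where "X m h = (\<Sum>v\<in>V. a v * (of_bool (h v = m) - 1 / K))" for m :: 'm and h
  have fin: "finite (set_pmf ?H)" using V M by (intro finite_set_Pi_pmf) auto
  have var: "measure_pmf.expectation ?H (\<lambda>h. (X m h)\<^sup>2) \<le> (\<Sum>v\<in>V. (a v)\<^sup>2) / K" if m: "m \<in> M" for m
  proof -
    have mean: "measure_pmf.expectation (pmf_of_set M) (\<lambda>c. of_bool (c = m)) = 1 / K"
      using M m by (simp add: integral_pmf_of_set K_def of_bool_def sum.delta)
    have int: "integrable (measure_pmf (pmf_of_set M)) g" for g :: "_ \<Rightarrow> real"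
      using M by (intro integrable_measure_pmf_finite) auto
    have "measure_pmf.expectation ?H (\<lambda>h. (X m h)\<^sup>2) =
      (\<Sum>v\<in>V. measure_pmf.expectation (pmf_of_set M) (\<lambda>c. (a v * (of_bool (c = m) - 1 / K))\<^sup>2))"
      unfolding X_def
      using V M mean by (intro expectation_square_sum_Pi_pmf) (auto simp: int)
    also have "\<dots> \<le> (\<Sum>v\<in>V. (a v)\<^sup>2 / K)"
    proof (intro sum_mono)
      fix v
      \<comment> \<open>For an indicator \<open>b\<close>,
        \<open>(b - 1/K)^2 = (1 - 2/K) * b + 1/K^2\<close>, whose mean is
        \<open>1/K - 1/K^2\<close>.\<close>
      have "measure_pmf.expectation (pmf_of_set M) (\<lambda>c. (a v * (of_bool (c = m) - 1 / K))\<^sup>2) =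
        measure_pmf.expectation (pmf_of_set M) (\<lambda>c. (a v)\<^sup>2 * ((1 - 2 / K) * of_bool (c = m) + 1 / K\<^sup>2))"
        using K by (intro Bochner_Integration.integral_cong refl)
           (auto simp: power2_eq_square field_simps of_bool_def)
      also have "\<dots> = (a v)\<^sup>2 * ((1 - 2 / K) * (1 / K) + 1 / K\<^sup>2)"
        using mean by (simp add: int)
      also have "\<dots> \<le> (a v)\<^sup>2 * (1 / K)"
        using K by (intro mult_left_mono) (auto simp: power2_eq_square field_simps)
      finally show "measure_pmf.expectation (pmf_of_set M) (\<lambda>c. (a v * (of_bool (c = m) - 1 / K))\<^sup>2)
        \<le> (a v)\<^sup>2 / K" by simp
    qed
    finally show ?thesis by (simp add: sum_divide_distrib)
  qed
  \<comment> \<open>The weights are chosen so that the constant terms of all \<open>K\<close>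
    messages add up to \<open>\<epsilon> / 2\<close>.\<close>
  have amgm: "\<bar>x\<bar> \<le> \<epsilon> / (2 * K) + K / (2 * \<epsilon>) * x\<^sup>2" for x
  proof -
    have "0 \<le> (\<epsilon> - K * \<bar>x\<bar>)\<^sup>2" by simp
    hence "2 * \<epsilon> * K * \<bar>x\<bar> \<le> \<epsilon>\<^sup>2 + K\<^sup>2 * x\<^sup>2"
      by (simp add: power2_diff power_mult_distrib algebra_simps)
    thus ?thesis using K \<epsilon> by (simp add: field_simps power2_eq_square)
  qed
  have "measure_pmf.expectation ?H (\<lambda>h. \<Sum>m\<in>M. \<bar>X m h\<bar>) = (\<Sum>m\<in>M. measure_pmf.expectation ?H (\<lambda>h. \<bar>X m h\<bar>))"
    by (rule expectation_sum_finite[OF fin])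
  also have "\<dots> \<le> (\<Sum>m\<in>M. \<epsilon> / (2 * K) + K / (2 * \<epsilon>) * ((\<Sum>v\<in>V. (a v)\<^sup>2) / K))"
  proof (intro sum_mono)
    fix m assume m: "m \<in> M"
    have "measure_pmf.expectation ?H (\<lambda>h. \<bar>X m h\<bar>) \<le>
          measure_pmf.expectation ?H (\<lambda>h. \<epsilon> / (2 * K) + K / (2 * \<epsilon>) * (X m h)\<^sup>2)"
      by (intro expectation_mono_pmf fin amgm)
    also have "\<dots> = \<epsilon> / (2 * K) + K / (2 * \<epsilon>) * measure_pmf.expectation ?H (\<lambda>h. (X m h)\<^sup>2)"
      by (simp add: integrable_measure_pmf_finite fin)
    also have "\<dots> \<le> \<epsilon> / (2 * K) + K / (2 * \<epsilon>) * ((\<Sum>v\<in>V. (a v)\<^sup>2) / K)"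
      using K \<epsilon> by (intro add_left_mono mult_left_mono var m) auto
    finally show "measure_pmf.expectation ?H (\<lambda>h. \<bar>X m h\<bar>) \<le> \<dots>" .
  qed
  also have "\<dots> = \<epsilon> / 2 + K * (\<Sum>v\<in>V. (a v)\<^sup>2) / (2 * \<epsilon>)"
    using K \<epsilon> by (simp add: K_def[symmetric] field_simps)
  finally show ?thesis by (simp add: X_def K_def)
qed

lemma exists_le_expectation:
  fixes g :: "'a \<Rightarrow> real"
  assumes "finite (set_pmf p)"
  obtains a where "a \<in> set_pmf p" "g a \<le> measure_pmf.expectation p g"
proof -
  obtain a where a: "a \<in> set_pmf p" "\<And>b. b \<in> set_pmf p \<Longrightarrow> g a \<le> g b"
    using assms set_pmf_not_empty by (metis arg_min_if_finite(1) arg_min_least)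
  have "measure_pmf.expectation p (\<lambda>_. g a) \<le> measure_pmf.expectation p g"
    by (intro expectation_mono_pmf assms a(2))
  thus ?thesis using that a by simp
qed

lemma expectation_commute:
  fixes g :: "'a \<Rightarrow> 'b \<Rightarrow> real"
  assumes "finite (set_pmf p)" "finite (set_pmf q)"
  shows "measure_pmf.expectation p (\<lambda>a. measure_pmf.expectation q (g a)) =
         measure_pmf.expectation q (\<lambda>b. measure_pmf.expectation p (\<lambda>a. g a b))"
  using assms
  by (simp add: integral_measure_pmf[of "set_pmf p"] integral_measure_pmf[of "set_pmf q"]
        sum_distrib_left mult_ac sum.swap[of _ "set_pmf p"])

lemma pmf_map_finite:
  assumes "finite V" "set_pmf p \<subseteq> V"
  shows "pmf (map_pmf f p) b = (\<Sum>v\<in>V. pmf p v * of_bool (f v = b))"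
proof -
  have "pmf (map_pmf f p) b = measure_pmf.expectation p (\<lambda>v. of_bool (v \<in> f -` {b}))"
    by (simp only: pmf_map prob_eq_expectation)
  also have "\<dots> = (\<Sum>v\<in>V. pmf p v * of_bool (f v = b))"
    using assms by (subst integral_measure_pmf[of V]) auto
  finally show ?thesis .
qed

lemma messages_eq: "messages n R = {1..nat \<lfloor>2 powr (real n * R)\<rfloor>}"
  unfolding messages_def by (auto simp: le_nat_floor le_floor_iff nat_le_iff) (simp add: le_nat_iff le_floor_iff)

lemma finite_messages [simp]: "finite (messages n R)"
  by (simp add: messages_eq)

lemma card_messages: "real (card (messages n R)) = of_int \<lfloor>2 powr (real n * R)\<rfloor>"
  by (simp add: messages_eq)

lemma card_messages_le: "real (card (messages n R)) \<le> 2 powr (real n * R)"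
  unfolding card_messages by simp

text \<open>A negative rate makes \<open>2 powr (real n * R)\<close> smaller than 1 once
  \<open>n\<close> is positive; this is how the converse obtains \<open>0 \<le> R\<close>.\<close>

lemma messages_nonempty_iff: "messages n R \<noteq> {} \<longleftrightarrow> n = 0 \<or> 0 \<le> R"
proof -
  have "messages n R \<noteq> {} \<longleftrightarrow> 2 powr 0 \<le> 2 powr (real n * R)"
    unfolding messages_eq by (simp add: le_nat_iff le_floor_iff)
  also have "\<dots> \<longleftrightarrow> 0 \<le> real n * R"
    by (subst powr_le_cancel_iff) auto
  finally show ?thesis by (auto simp: zero_le_mult_iff)
qed

text \<open>Values of conditional probability at most \<open>\<beta>\<close> have squared
  probabilities summing to at most \<open>\<beta>\<close>, so the variance bound controls them; the
  others are charged twice their mass. The bound holds for each \<open>s\<close> in mean over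
  \<open>h\<close>; exchanging the two means gives one \<open>h\<close> that is good in mean over
  \<open>s\<close>, as a decoder ignorant of the state requires.\<close>

lemma one_shot_hashing:
  fixes q :: "'s \<Rightarrow> 'v pmf" and M :: "'m set" and \<beta> :: real
  assumes fp: "finite (set_pmf p)" and fq: "\<And>s. s \<in> set_pmf p \<Longrightarrow> finite (set_pmf (q s))"
    and M: "finite M" "M \<noteq> {}" and \<epsilon>: "0 < \<epsilon>" and \<beta>: "0 \<le> \<beta>"
  obtains h where "\<And>v. h v \<in> M"
    "measure_pmf.expectation p (\<lambda>s. \<Sum>m\<in>M. \<bar>pmf (map_pmf h (q s)) m - 1 / card M\<bar>) \<le>
       \<epsilon> / 2 + card M * \<beta> / (2 * \<epsilon>) +
       2 * measure_pmf.expectation p (\<lambda>s. measure_pmf.expectation (q s) (\<lambda>v. of_bool (\<beta> < pmf (q s) v)))"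
proof -
  define V where "V = (\<Union>s\<in>set_pmf p. set_pmf (q s))"
  obtain m0 where m0: "m0 \<in> M" using M by blast
  \<comment> \<open>The default \<open>m0\<close> lies in \<open>M\<close>, so \<open>h v\<close> is
    a message even for \<open>v\<close> outside \<open>V\<close>.\<close>
  define H where "H = Pi_pmf V m0 (\<lambda>_. pmf_of_set M)"
  define K where "K = real (card M)"
  have K: "0 < K" using M by (auto simp: K_def card_gt_0_iff)
  have V: "finite V" using fp fq by (auto simp: V_def)
  have fH: "finite (set_pmf H)" unfolding H_def using V M by (intro finite_set_Pi_pmf) auto
  have hM: "h v \<in> M" if "h \<in> set_pmf H" for h v
    using that V M m0 by (auto simp: H_def set_Pi_pmf PiE_dflt_def)
  define a where "a s v = pmf (q s) v * of_bool (pmf (q s) v \<le> \<beta>)" for s v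
  define b where "b s v = pmf (q s) v * of_bool (\<beta> < pmf (q s) v)" for s v
  define F where "F h s = (\<Sum>m\<in>M. \<bar>pmf (map_pmf h (q s)) m - 1 / K\<bar>)" for h s
  define G where "G s = \<epsilon> / 2 + K * \<beta> / (2 * \<epsilon>) +
    2 * measure_pmf.expectation (q s) (\<lambda>v. of_bool (\<beta> < pmf (q s) v))" for s
  have main: "measure_pmf.expectation H (\<lambda>h. F h s) \<le> G s" if s: "s \<in> set_pmf p" for s
  proof -
    have sV: "set_pmf (q s) \<subseteq> V" using s by (auto simp: V_def)
    have s1: "(\<Sum>v\<in>V. pmf (q s) v) = 1" using V sV by (rule sum_pmf_eq_1)
    have dev: "pmf (map_pmf h (q s)) m - 1 / K =
        (\<Sum>v\<in>V. a s v * (of_bool (h v = m) - 1 / K)) + (\<Sum>v\<in>V. b s v * (of_bool (h v = m) - 1 / K))" for h m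
    proof -
      have "pmf (map_pmf h (q s)) m - 1 / K = (\<Sum>v\<in>V. pmf (q s) v * of_bool (h v = m)) - (\<Sum>v\<in>V. pmf (q s) v) * (1 / K)"
        by (simp add: pmf_map_finite[OF V sV] s1)
      also have "\<dots> = (\<Sum>v\<in>V. pmf (q s) v * (of_bool (h v = m) - 1 / K))"
        by (simp add: sum_divide_distrib right_diff_distrib sum_subtractf)
      also have "\<dots> = (\<Sum>v\<in>V. a s v * (of_bool (h v = m) - 1 / K) + b s v * (of_bool (h v = m) - 1 / K))"
        by (intro sum.cong refl) (auto simp: a_def b_def)
      finally show ?thesis by (simp add: sum.distrib)
    qed
    have "F h s \<le> (\<Sum>m\<in>M. \<bar>\<Sum>v\<in>V. a s v * (of_bool (h v = m) - 1 / K)\<bar>) + 2 * (\<Sum>v\<in>V. b s v)"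
      if h: "h \<in> set_pmf H" for h
    proof -
      have bb: "\<bar>\<Sum>v\<in>V. b s v * (of_bool (h v = m) - 1 / K)\<bar> \<le> (\<Sum>v\<in>V. b s v * (of_bool (h v = m) + 1 / K))" for m
      proof -
        have "\<bar>\<Sum>v\<in>V. b s v * (of_bool (h v = m) - 1 / K)\<bar> \<le> (\<Sum>v\<in>V. \<bar>b s v * (of_bool (h v = m) - 1 / K)\<bar>)"
          by (rule sum_abs)
        also have "\<dots> \<le> (\<Sum>v\<in>V. b s v * (of_bool (h v = m) + 1 / K))"
        proof (intro sum_mono)
          fix v
          have "\<bar>of_bool (h v = m) - 1 / K\<bar> \<le> of_bool (h v = m) + 1 / K"
            using abs_triangle_ineq4[of "of_bool (h v = m)" "1 / K"] K by simp
          thus "\<bar>b s v * (of_bool (h v = m) - 1 / K)\<bar> \<le> b s v * (of_bool (h v = m) + 1 / K)"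
            unfolding abs_mult by (intro mult_mono) (auto simp: b_def)
        qed
        finally show ?thesis .
      qed
      have "F h s \<le> (\<Sum>m\<in>M. \<bar>\<Sum>v\<in>V. a s v * (of_bool (h v = m) - 1 / K)\<bar> + (\<Sum>v\<in>V. b s v * (of_bool (h v = m) + 1 / K)))"
        unfolding F_def dev by (intro sum_mono order_trans[OF abs_triangle_ineq] add_left_mono bb)
      also have "(\<Sum>m\<in>M. \<bar>\<Sum>v\<in>V. a s v * (of_bool (h v = m) - 1 / K)\<bar> + (\<Sum>v\<in>V. b s v * (of_bool (h v = m) + 1 / K))) =
        (\<Sum>m\<in>M. \<bar>\<Sum>v\<in>V. a s v * (of_bool (h v = m) - 1 / K)\<bar>) + (\<Sum>v\<in>V. b s v * (\<Sum>m\<in>M. of_bool (h v = m) + 1 / K))"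
        by (subst sum.distrib, subst sum.swap) (simp only: sum_distrib_left)
      \<comment> \<open>Each \<open>v\<close> hits exactly one message and is compared with the
        share \<open>1 / K\<close> at all \<open>K\<close> of them, hence the factor
        \<open>1 + K * (1 / K) = 2\<close>.\<close>
      also have "(\<Sum>v\<in>V. b s v * (\<Sum>m\<in>M. of_bool (h v = m) + 1 / K)) = (\<Sum>v\<in>V. b s v * 2)"
      proof (intro sum.cong refl)
        fix v
        have "(\<Sum>m\<in>M. of_bool (h v = m) + 1 / K) = 1 + K * (1 / K)"
          using M hM[OF h, of v] by (simp add: sum.distrib of_bool_def sum.delta' K_def)
        thus "b s v * (\<Sum>m\<in>M. of_bool (h v = m) + 1 / K) = b s v * 2" using K by simp
      qed
      finally show ?thesis by (simp add: sum_distrib_left mult.commute)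
    qed
    hence "measure_pmf.expectation H (\<lambda>h. F h s) \<le>
       measure_pmf.expectation H (\<lambda>h. (\<Sum>m\<in>M. \<bar>\<Sum>v\<in>V. a s v * (of_bool (h v = m) - 1 / K)\<bar>) + 2 * (\<Sum>v\<in>V. b s v))"
      by (intro expectation_mono_pmf fH)
    also have "\<dots> = measure_pmf.expectation H (\<lambda>h. \<Sum>m\<in>M. \<bar>\<Sum>v\<in>V. a s v * (of_bool (h v = m) - 1 / K)\<bar>) + 2 * (\<Sum>v\<in>V. b s v)"
      by (simp add: integrable_measure_pmf_finite[OF fH] del: Bochner_Integration.integral_sum)
    also have "measure_pmf.expectation H (\<lambda>h. \<Sum>m\<in>M. \<bar>\<Sum>v\<in>V. a s v * (of_bool (h v = m) - 1 / K)\<bar>)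
        \<le> \<epsilon> / 2 + K * (\<Sum>v\<in>V. (a s v)\<^sup>2) / (2 * \<epsilon>)"
      unfolding H_def K_def by (rule random_hash_deviation) (use V M \<epsilon> in auto)
    also have "(\<Sum>v\<in>V. (a s v)\<^sup>2) \<le> (\<Sum>v\<in>V. pmf (q s) v * \<beta>)"
      by (intro sum_mono) (auto simp: a_def power2_eq_square \<beta> intro!: mult_left_mono)
    also have "\<dots> = \<beta>" by (simp add: s1 flip: sum_distrib_right)
    also have "(\<Sum>v\<in>V. b s v) = measure_pmf.expectation (q s) (\<lambda>v. of_bool (\<beta> < pmf (q s) v))"
      using V sV by (subst integral_measure_pmf[of V]) (auto simp: b_def)
    finally show ?thesis unfolding G_def using K \<epsilon> by (simp add: divide_right_mono mult_left_mono)
  qed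
  obtain h where h: "h \<in> set_pmf H" and
    hb: "measure_pmf.expectation p (F h) \<le> measure_pmf.expectation H (\<lambda>h. measure_pmf.expectation p (F h))"
    using exists_le_expectation[OF fH] .
  note hb
  also have "measure_pmf.expectation H (\<lambda>h. measure_pmf.expectation p (F h)) =
      measure_pmf.expectation p (\<lambda>s. measure_pmf.expectation H (\<lambda>h. F h s))"
    by (rule expectation_commute) (use fp fH in auto)
  also have "\<dots> \<le> measure_pmf.expectation p G"
    by (intro expectation_mono_pmf fp main)
  also have "\<dots> = \<epsilon> / 2 + K * \<beta> / (2 * \<epsilon>) +
      2 * measure_pmf.expectation p (\<lambda>s. measure_pmf.expectation (q s) (\<lambda>v. of_bool (\<beta> < pmf (q s) v)))"
    unfolding G_def by (simp add: integrable_measure_pmf_finite[OF fp])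
  finally show ?thesis
    using that[of h] hM[OF h] unfolding F_def K_def by blast
qed

section \<open>Product laws on sequences and hashing of long blocks\<close>

lemma set_iid_subset_seqs: "set_pmf (Pi_pmf {..<n} undefined p) \<subseteq> seqs n"
  using set_Pi_pmf_subset[of "{..<n}" undefined p]
  by (auto simp: seqs_def PiE_def extensional_def)

text \<open>Independent letters and their independent kernel outputs form independent pairs.
  Unzipping recovers both sequences exactly because they are \<open>undefined\<close> outside
  \<open>{..<n}\<close>, as is every result of \<open>seq_map\<close>.\<close>

lemma bind_iid_kernel:
  "bind_pmf (Pi_pmf {..<n} undefined p) (\<lambda>a. bind_pmf (Pi_pmf {..<n} undefined (\<lambda>i. k i (a i))) (g a)) =
   bind_pmf (Pi_pmf {..<n} undefined (\<lambda>i. bind_pmf (p i) (\<lambda>a. map_pmf (Pair a) (k i a))))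
     (\<lambda>w. g (seq_map n fst w) (seq_map n snd w))"
proof -
  have "bind_pmf (Pi_pmf {..<n} undefined (\<lambda>i. bind_pmf (p i) (\<lambda>a. map_pmf (Pair a) (k i a))))
     (\<lambda>w. g (seq_map n fst w) (seq_map n snd w)) =
     bind_pmf (Pi_pmf {..<n} undefined p) (\<lambda>a. bind_pmf (Pi_pmf {..<n} undefined (\<lambda>i. k i (a i)))
       (\<lambda>b. g (seq_map n fst (\<lambda>i. if i \<in> {..<n} then (a i, b i) else undefined))
              (seq_map n snd (\<lambda>i. if i \<in> {..<n} then (a i, b i) else undefined))))"
    by (simp add: Pi_pmf_bind[where d' = undefined] map_pmf_def bind_assoc_pmf bind_return_pmf del: Pi_pmf_return_pmf)
       (simp add: bind_return_pmf)
  also have "\<dots> = bind_pmf (Pi_pmf {..<n} undefined p) (\<lambda>a. bind_pmf (Pi_pmf {..<n} undefined (\<lambda>i. k i (a i))) (g a))"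
  proof (intro bind_pmf_cong refl)
    fix a b
    assume "a \<in> set_pmf (Pi_pmf {..<n} undefined p)" "b \<in> set_pmf (Pi_pmf {..<n} undefined (\<lambda>i. k i (a i)))"
    hence "a \<in> seqs n" "b \<in> seqs n" using set_iid_subset_seqs by blast+
    hence "seq_map n fst (\<lambda>i. if i \<in> {..<n} then (a i, b i) else undefined) = a"
      "seq_map n snd (\<lambda>i. if i \<in> {..<n} then (a i, b i) else undefined) = b"
      by (auto simp: seq_map_def seqs_def fun_eq_iff PiE_def extensional_def)
    thus "g (seq_map n fst (\<lambda>i. if i \<in> {..<n} then (a i, b i) else undefined))
            (seq_map n snd (\<lambda>i. if i \<in> {..<n} then (a i, b i) else undefined)) = g a b" by simp
  qed
  finally show ?thesis ..
qed

lemma expectation_iid_kernel: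
  fixes p :: "nat \<Rightarrow> 'a::finite pmf" and k :: "nat \<Rightarrow> 'a \<Rightarrow> 'b::finite pmf" and G :: "_ \<Rightarrow> _ \<Rightarrow> real"
  shows "measure_pmf.expectation (Pi_pmf {..<n} undefined p)
     (\<lambda>a. measure_pmf.expectation (Pi_pmf {..<n} undefined (\<lambda>i. k i (a i))) (G a)) =
   measure_pmf.expectation (Pi_pmf {..<n} undefined (\<lambda>i. bind_pmf (p i) (\<lambda>a. map_pmf (Pair a) (k i a))))
     (\<lambda>w. G (seq_map n fst w) (seq_map n snd w))"
  using arg_cong[OF bind_iid_kernel[of n p k "\<lambda>a b. return_pmf (a, b)"],
    of "\<lambda>p. measure_pmf.expectation p (\<lambda>(a, b). G a b)"]
  by (simp add: expectation_bind_pmf finite_set_Pi_pmf)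

text \<open>The lower tail is the relevant one: an output sequence is too likely for hashing when
  its information density is too small.\<close>

lemma chebyshev_iid:
  fixes g :: "'a \<Rightarrow> real"
  assumes fin: "finite (set_pmf p)" and n: "0 < n" and \<gamma>: "0 < \<gamma>"
  defines "\<mu> \<equiv> measure_pmf.expectation p g"
  shows "measure_pmf.expectation (Pi_pmf {..<n} dflt (\<lambda>_. p)) (\<lambda>w. of_bool ((\<Sum>i<n. g (w i)) \<le> real n * (\<mu> - \<gamma>)))
    \<le> measure_pmf.expectation p (\<lambda>a. (g a - \<mu>)\<^sup>2) / (real n * \<gamma>\<^sup>2)"
proof -
  let ?Q = "Pi_pmf {..<n} dflt (\<lambda>_. p)"
  have finQ: "finite (set_pmf ?Q)" using fin by (intro finite_set_Pi_pmf) auto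
  have int: "integrable (measure_pmf p) f" for f :: "_ \<Rightarrow> real"
    using fin by (rule integrable_measure_pmf_finite)
  have "measure_pmf.expectation ?Q (\<lambda>w. of_bool ((\<Sum>i<n. g (w i)) \<le> real n * (\<mu> - \<gamma>))) \<le>
    measure_pmf.expectation ?Q (\<lambda>w. (\<Sum>i<n. g (w i) - \<mu>)\<^sup>2 / (real n * \<gamma>)\<^sup>2)"
  proof (intro expectation_mono_pmf finQ)
    fix w
    show "of_bool ((\<Sum>i<n. g (w i)) \<le> real n * (\<mu> - \<gamma>)) \<le> (\<Sum>i<n. g (w i) - \<mu>)\<^sup>2 / (real n * \<gamma>)\<^sup>2"
    proof (cases "(\<Sum>i<n. g (w i)) \<le> real n * (\<mu> - \<gamma>)")
      case True
      hence "real n * \<gamma> \<le> \<bar>\<Sum>i<n. g (w i) - \<mu>\<bar>"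
        by (simp add: sum_subtractf algebra_simps)
      hence "(real n * \<gamma>)\<^sup>2 \<le> (\<Sum>i<n. g (w i) - \<mu>)\<^sup>2"
        using n \<gamma> by (simp add: abs_le_square_iff[symmetric])
      thus ?thesis using True n \<gamma> by simp
    qed auto
  qed
  also have "\<dots> = measure_pmf.expectation ?Q (\<lambda>w. (\<Sum>i<n. g (w i) - \<mu>)\<^sup>2) / (real n * \<gamma>)\<^sup>2"
    by simp
  also have "measure_pmf.expectation ?Q (\<lambda>w. (\<Sum>i<n. g (w i) - \<mu>)\<^sup>2) =
     (\<Sum>i<n. measure_pmf.expectation p (\<lambda>a. (g a - \<mu>)\<^sup>2))"
    using fin by (intro expectation_square_sum_Pi_pmf) (auto simp: int \<mu>_def)
  also have "\<dots> / (real n * \<gamma>)\<^sup>2 = measure_pmf.expectation p (\<lambda>a. (g a - \<mu>)\<^sup>2) / (real n * \<gamma>\<^sup>2)"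
    using n \<gamma> by (simp add: power2_eq_square)
  finally show ?thesis .
qed

lemma eventually_good_hash:
  fixes p :: "'e::finite pmf" and q :: "'e \<Rightarrow> 'v::finite pmf"
  assumes R: "0 \<le> R" "R < measure_pmf.expectation (bind_pmf p (\<lambda>e. map_pmf (Pair e) (q e))) (\<lambda>(e, v). - log 2 (pmf (q e) v))"
    and \<epsilon>: "0 < \<epsilon>"
  shows "\<forall>\<^sub>F n in sequentially. \<exists>h. (\<forall>v. h v \<in> messages n R) \<and>
     measure_pmf.expectation (Pi_pmf {..<n} undefined (\<lambda>_. p))
       (\<lambda>s. total_variation (messages n R) (pmf_of_set (messages n R))
              (map_pmf h (Pi_pmf {..<n} undefined (\<lambda>i. q (s i))))) \<le> \<epsilon>"
proof -
  let ?p = "bind_pmf p (\<lambda>e. map_pmf (Pair e) (q e))"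
  define g where "g = (\<lambda>(e, v). - log 2 (pmf (q e) v))"
  define H where "H = measure_pmf.expectation ?p g"
  \<comment> \<open>Half of the gap: since \<open>R = H - 2 * \<gamma>\<close>, the number of
    messages times the threshold \<open>2 powr (- (real n * (H - \<gamma>)))\<close> is at most
    \<open>2 powr (- (real n * \<gamma>))\<close>, and a margin \<open>\<gamma>\<close> is left for
    Chebyshev's inequality.\<close>
  define \<gamma> where "\<gamma> = (H - R) / 2"
  define \<sigma> where "\<sigma> = measure_pmf.expectation ?p (\<lambda>a. (g a - H)\<^sup>2)"
  have \<gamma>: "0 < \<gamma>" using R by (simp add: \<gamma>_def H_def g_def)
  have fin: "finite (set_pmf ?p)" by simp
  have ev1: "\<forall>\<^sub>F n in sequentially. 2 powr (- (real n * \<gamma>)) / (2 * \<epsilon>) < \<epsilon> / 4"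
  proof -
    have "(\<lambda>n. 2 powr (- (real n * \<gamma>)) / (2 * \<epsilon>)) \<longlonglongrightarrow> 0" using \<gamma> \<epsilon> by real_asymp
    from order_tendstoD(2)[OF this, of "\<epsilon> / 4"] \<epsilon> show ?thesis by simp
  qed
  have ev2: "\<forall>\<^sub>F n in sequentially. 2 * (\<sigma> / (real n * \<gamma>\<^sup>2)) < \<epsilon> / 4"
  proof -
    have "(\<lambda>n. 2 * (\<sigma> / (real n * \<gamma>\<^sup>2))) \<longlonglongrightarrow> 0" using \<gamma> by real_asymp
    from order_tendstoD(2)[OF this, of "\<epsilon> / 4"] \<epsilon> show ?thesis by simp
  qed
  have ev3: "\<forall>\<^sub>F n::nat in sequentially. 0 < n" by (rule eventually_gt_at_top)
  show ?thesis using ev1 ev2 ev3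
  proof eventually_elim
    case (elim n)
    define M where "M = messages n R"
    have M: "finite M" "M \<noteq> {}" using R by (auto simp: M_def messages_nonempty_iff)
    define \<beta> where "\<beta> = 2 powr (- (real n * (H - \<gamma>)))"
    let ?s = "Pi_pmf {..<n} undefined (\<lambda>_. p)"
    let ?q = "\<lambda>s. Pi_pmf {..<n} undefined (\<lambda>i. q (s i))"
    obtain h where h: "\<And>v. h v \<in> M" and hb:
      "measure_pmf.expectation ?s (\<lambda>s. \<Sum>m\<in>M. \<bar>pmf (map_pmf h (?q s)) m - 1 / card M\<bar>) \<le>
       \<epsilon> / 2 + card M * \<beta> / (2 * \<epsilon>) +
       2 * measure_pmf.expectation ?s (\<lambda>s. measure_pmf.expectation (?q s) (\<lambda>v. of_bool (\<beta> < pmf (?q s) v)))"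
      using one_shot_hashing[of ?s ?q M \<epsilon> \<beta>] M \<epsilon> by (auto simp: finite_set_Pi_pmf \<beta>_def)
    have "measure_pmf.expectation ?s (\<lambda>s. total_variation M (pmf_of_set M) (map_pmf h (?q s))) \<le>
      measure_pmf.expectation ?s (\<lambda>s. \<Sum>m\<in>M. \<bar>pmf (map_pmf h (?q s)) m - 1 / card M\<bar>)"
      using M
      by (intro expectation_mono_pmf finite_set_Pi_pmf order_trans[OF total_variation_le_l1] sum_mono)
         (auto simp: abs_minus_commute)
    also note hb
    also have "card M * \<beta> / (2 * \<epsilon>) \<le> \<epsilon> / 4"
    proof -
      have "card M * \<beta> \<le> 2 powr (real n * R) * \<beta>"
        unfolding M_def by (intro mult_right_mono card_messages_le) (auto simp: \<beta>_def)
      also have "\<dots> = 2 powr (- (real n * \<gamma>))"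
        unfolding \<beta>_def powr_add[symmetric]
        by (intro arg_cong[of _ _ "(powr) 2"]) (simp add: \<gamma>_def field_simps)
      finally show ?thesis using elim(1) \<epsilon> by (auto simp: divide_right_mono field_simps)
    qed
    also have "measure_pmf.expectation ?s (\<lambda>s. measure_pmf.expectation (?q s) (\<lambda>v. of_bool (\<beta> < pmf (?q s) v))) \<le> (
      measure_pmf.expectation ?s (\<lambda>s. measure_pmf.expectation (?q s) (\<lambda>v. of_bool ((\<Sum>i<n. g (s i, v i)) \<le> real n * (H - \<gamma>)))) :: real)"
    proof (rule expectation_mono_pmf[OF _ expectation_mono_pmf])
      \<comment> \<open>On the support every factor is positive, so the product is
        \<open>2 powr\<close> of minus the summed information density, and exceeding
        \<open>\<beta>\<close> becomes a lower-tail event.\<close>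
      fix s v assume v: "v \<in> set_pmf (?q s)"
      have pos: "0 < pmf (q (s i)) (v i)" if "i < n" for i
        using v that by (auto simp: set_Pi_pmf PiE_dflt_def pmf_positive_iff)
      have "pmf (?q s) v = (\<Prod>i<n. pmf (q (s i)) (v i))"
        using v set_Pi_pmf_subset[of "{..<n}" undefined "\<lambda>i. q (s i)"] by (intro pmf_Pi') auto
      also have "\<dots> = (\<Prod>i<n. 2 powr (- g (s i, v i)))"
        using pos by (intro prod.cong refl) (simp add: g_def)
      also have "\<dots> = 2 powr (- (\<Sum>i<n. g (s i, v i)))"
        by (simp add: powr_sum sum_negf flip: sum_negf)
      finally show "of_bool (\<beta> < pmf (?q s) v) \<le> (of_bool ((\<Sum>i<n. g (s i, v i)) \<le> real n * (H - \<gamma>)) :: real)"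
        by (simp add: \<beta>_def)
    qed (auto intro: finite_set_Pi_pmf)
    also have "\<dots> = measure_pmf.expectation (Pi_pmf {..<n} undefined (\<lambda>_. ?p))
        (\<lambda>w. of_bool ((\<Sum>i<n. g (w i)) \<le> real n * (H - \<gamma>)))"
    proof -
      have "(\<Sum>i<n. g (seq_map n fst w i, seq_map n snd w i)) = (\<Sum>i<n. g (w i))" for w
        by (intro sum.cong refl) (simp add: seq_map_def)
      thus ?thesis
        unfolding expectation_iid_kernel[of n "\<lambda>_. p" "\<lambda>_. q"] by simp
    qed
    also have "\<dots> \<le> \<sigma> / (real n * \<gamma>\<^sup>2)"
      using chebyshev_iid[OF fin elim(3) \<gamma>, of undefined g] by (simp add: \<sigma>_def H_def)
    finally have "measure_pmf.expectation ?s (\<lambda>s. total_variation M (pmf_of_set M) (map_pmf h (?q s))) \<le>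
       \<epsilon> / 2 + \<epsilon> / 4 + 2 * (\<sigma> / (real n * \<gamma>\<^sup>2))" by simp
    with elim(2) have "measure_pmf.expectation ?s (\<lambda>s. total_variation M (pmf_of_set M) (map_pmf h (?q s))) \<le> \<epsilon>"
      by simp
    with h show ?case unfolding M_def by blast
  qed
qed

section \<open>Achievability\<close>

text \<open>Mean information density is the form of the entropy to which the hashing bound
  refers.\<close>

lemma output_entropy_eq_expectation:
  fixes P :: "('e::finite \<times> 'f::finite) pmf" and y :: "'x \<Rightarrow> 'e \<Rightarrow> 'y::finite"
  shows "output_entropy P y PX =
    measure_pmf.expectation (bind_pmf (map_pmf fst P) (\<lambda>e. map_pmf (Pair e) (output_law y PX e)))
      (\<lambda>(e, v). - log 2 (pmf (output_law y PX e) v))"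
proof -
  have "measure_pmf.expectation (map_pmf (Pair e) (output_law y PX e)) (\<lambda>(e, v). - log 2 (pmf (output_law y PX e) v))
    = (\<Sum>v\<in>UNIV. pmf (output_law y PX e) v * - log 2 (pmf (output_law y PX e) v))" for e
    by (simp only: integral_map_pmf prod.case) (simp add: integral_measure_pmf[of UNIV] sum_negf)
  hence "measure_pmf.expectation (bind_pmf (map_pmf fst P) (\<lambda>e. map_pmf (Pair e) (output_law y PX e)))
      (\<lambda>(e, v). - log 2 (pmf (output_law y PX e) v)) =
    measure_pmf.expectation (map_pmf fst P)
      (\<lambda>e. \<Sum>v\<in>UNIV. pmf (output_law y PX e) v * - log 2 (pmf (output_law y PX e) v))"
    by (subst expectation_bind_pmf) simp_all
  thus ?thesis
    unfolding output_entropy_def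
    by (subst (asm) (2) integral_measure_pmf[of UNIV]) (simp_all add: sum_distrib_left)
qed

text \<open>The uniform message is first coupled maximally with \<open>f x\<close>, and then
  \<open>x\<close> is drawn from its conditional law given that value. The law of \<open>x\<close>
  stays exactly \<open>q\<close>, and disagreement is as rare as in the maximal coupling.\<close>

lemma coupling_through_map:
  assumes M: "finite M" "M \<noteq> {}" and f: "f ` set_pmf q \<subseteq> M"
  obtains c where "map_pmf fst c = pmf_of_set M" "map_pmf snd c = q"
    "measure_pmf.prob c {(m, x). m \<noteq> f x} \<le> total_variation M (pmf_of_set M) (map_pmf f q)"
proof -
  obtain r where r: "map_pmf fst r = pmf_of_set M" "map_pmf snd r = map_pmf f q"
    "measure_pmf.prob r {(a, b). a \<noteq> b} \<le> total_variation M (pmf_of_set M) (map_pmf f q)"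
    using maximal_coupling[of M "pmf_of_set M" "map_pmf f q"] M f by auto
  define g where "g = map_pmf (\<lambda>x. (f x, x)) q"
  obtain k where k: "g = bind_pmf (map_pmf fst g) (\<lambda>b. map_pmf (Pair b) (k b))"
    using pmf_disintegration_bind by blast
  have g1: "map_pmf fst g = map_pmf f q" and g2: "map_pmf snd g = q"
    by (simp_all add: g_def map_pmf_comp)
  \<comment> \<open>The claim is limited to values of positive mass, since the conditional kernel
    \<open>k\<close> is arbitrary elsewhere.\<close>
  have fk: "f x = b" if "b \<in> set_pmf (map_pmf snd r)" "x \<in> set_pmf (k b)" for x b
  proof -
    have "(b, x) \<in> set_pmf (bind_pmf (map_pmf fst g) (\<lambda>b. map_pmf (Pair b) (k b)))"
      using that unfolding r(2) g1 by auto
    hence "(b, x) \<in> set_pmf g" using k by simp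
    thus ?thesis by (auto simp: g_def)
  qed
  define c where "c = bind_pmf r (\<lambda>w. map_pmf (Pair (fst w)) (k (snd w)))"
  have "map_pmf fst c = pmf_of_set M"
    unfolding c_def r(1)[symmetric] by (simp add: map_bind_pmf map_pmf_comp) (simp add: map_pmf_def)
  moreover have "map_pmf snd c = q"
  proof -
    have "map_pmf snd c = bind_pmf (map_pmf snd r) k"
      by (simp add: c_def map_bind_pmf map_pmf_comp bind_map_pmf)
    also have "\<dots> = map_pmf snd g"
      unfolding r(2) g1[symmetric] by (subst (2) k) (simp add: map_bind_pmf map_pmf_comp)
    finally show ?thesis using g2 by simp
  qed
  moreover have "map_pmf (\<lambda>(m, x). (m, f x)) c = r"
  proof -
    have "map_pmf (\<lambda>(m, x). (m, f x)) c = bind_pmf r (\<lambda>w. map_pmf (\<lambda>x. (fst w, f x)) (k (snd w)))"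
      by (simp add: c_def map_bind_pmf map_pmf_comp)
    also have "\<dots> = bind_pmf r (\<lambda>w. map_pmf (\<lambda>x. w) (k (snd w)))"
    proof (intro bind_pmf_cong map_pmf_cong refl)
      fix w x assume "w \<in> set_pmf r" "x \<in> set_pmf (k (snd w))"
      thus "(fst w, f x) = w" using fk[of "snd w" x] by simp
    qed
    also have "\<dots> = r" by (simp add: map_pmf_const bind_return_pmf')
    finally show ?thesis .
  qed
  hence "measure_pmf.prob c {(m, x). m \<noteq> f x} = measure_pmf.prob r {(a, b). a \<noteq> b}"
    by (auto simp: vimage_def case_prod_unfold dest: sym)
  ultimately show ?thesis using that r(3) by auto
qed

lemma map_seq_map_Pi_pmf:
  "map_pmf (seq_map n f) (Pi_pmf {..<n} undefined p) = Pi_pmf {..<n} undefined (\<lambda>i. map_pmf f (p i))"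
  by (simp add: map_pmf_def Pi_pmf_bind[where d' = undefined] seq_map_def restrict_def)

lemma memoryless_deterministic:
  assumes W: "\<And>x s. W x s = map_pmf (Pair (y x (fst s))) (PZ x (fst s) (snd s))"
  shows "memoryless n W x s = map_pmf (\<lambda>z. \<lambda>i\<in>{..<n}. (y (x i) (fst (s i)), z i))
      (Pi_pmf {..<n} undefined (\<lambda>i. PZ (x i) (fst (s i)) (snd (s i))))"
  unfolding memoryless_def W
  by (simp add: map_pmf_def Pi_pmf_bind[where d' = undefined] restrict_def)

text \<open>The coupling is made separately for each state sequence, but its message marginal is
  always uniform; disintegrating it along the message gives an encoder that leaves the message
  independent of the state. Averaged over the message, the input is drawn letterwise from
  \<open>PX\<close>, hence an equality for the distortion.\<close>

lemma code_from_hash: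
  fixes P :: "('e::finite \<times> 'f::finite) pmf"
    and W :: "'x::finite \<Rightarrow> 'e \<times> 'f \<Rightarrow> ('y::finite \<times> 'z::finite) pmf"
    and h :: "(nat \<Rightarrow> 'y) \<Rightarrow> nat"
  assumes W: "\<And>x s. W x s = map_pmf (Pair (y x (fst s))) (PZ x (fst s) (snd s))"
    and n: "0 < n" and h: "\<And>v. h v \<in> messages n R"
    and mT: "map_pmf (\<lambda>(x, se, sf, v, z, t). t) (joint_law P y PZ PX PT) = P"
  obtains enc dec est where "is_code n R enc dec est"
    "measure_pmf.prob (code_law P W n R enc dec est) {(m, m', s, t). m \<noteq> m'} \<le>
       measure_pmf.expectation (Pi_pmf {..<n} undefined (\<lambda>_. map_pmf fst P))
       (\<lambda>s. total_variation (messages n R) (pmf_of_set (messages n R))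
              (map_pmf h (Pi_pmf {..<n} undefined (\<lambda>i. output_law y PX (s i)))))"
    "measure_pmf.expectation (code_law P W n R enc dec est) (\<lambda>(m, m', s, t). avg_distortion n d s t) =
       measure_pmf.expectation (joint_law P y PZ PX PT) (\<lambda>(x, se, sf, v, z, t). d (se, sf) t)"
    "map_pmf (\<lambda>(m, m', s, t). t) (code_law P W n R enc dec est) = iid n P"
proof -
  define M where "M = messages n R"
  have M: "finite M" "M \<noteq> {}" using h by (auto simp: M_def)
  define q where "q s = Pi_pmf {..<n} undefined (\<lambda>i. PX (s i))" for s :: "nat \<Rightarrow> 'e"
  define hx where "hx s x = h (\<lambda>i\<in>{..<n}. y (x i) (s i))" for s x
  define TV where "TV s = total_variation M (pmf_of_set M)
     (map_pmf h (Pi_pmf {..<n} undefined (\<lambda>i. output_law y PX (s i))))" for s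
  \<comment> \<open>Letterwise functions of independent inputs are independent, with law
    \<open>output_law\<close>, so a bound on hashed outputs is a bound on hashed inputs.\<close>
  have hq: "map_pmf (hx s) (q s) = map_pmf h (Pi_pmf {..<n} undefined (\<lambda>i. output_law y PX (s i)))" for s
    unfolding q_def hx_def output_law_def
    by (simp add: map_pmf_def Pi_pmf_bind[where d' = undefined] bind_assoc_pmf bind_return_pmf restrict_def)
  have "\<exists>c. map_pmf fst c = pmf_of_set M \<and> map_pmf snd c = q s \<and>
     measure_pmf.prob c {(m, x). m \<noteq> hx s x} \<le> TV s" for s
  proof -
    have "hx s ` set_pmf (q s) \<subseteq> M" using h by (auto simp: hx_def M_def)
    from coupling_through_map[OF M this] show ?thesis unfolding TV_def hq by metis
  qed
  then obtain c where c: "\<And>s. map_pmf fst (c s) = pmf_of_set M" "\<And>s. map_pmf snd (c s) = q s"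
    "\<And>s. measure_pmf.prob (c s) {(m, x). m \<noteq> hx s x} \<le> TV s"
    by metis
  have "\<exists>k. c s = bind_pmf (pmf_of_set M) (\<lambda>m. map_pmf (Pair m) (k m))" for s
    using pmf_disintegration_bind[of "c s"] unfolding c(1) by metis
  then obtain k where k: "\<And>s. c s = bind_pmf (pmf_of_set M) (\<lambda>m. map_pmf (Pair m) (k s m))"
    by metis
  define enc where "enc m s = k s m" for m s
  define est where "est x s z = Pi_pmf {..<n} undefined (\<lambda>i. PT (x i) (s i) (z i))"
    for x and s :: "nat \<Rightarrow> 'e" and z
  let ?Q = "code_law P W n R enc h est"
  have set_enc: "set_pmf (enc m s) \<subseteq> seqs n" if "m \<in> M" for m s
  proof
    fix x assume "x \<in> set_pmf (enc m s)"
    hence "(m, x) \<in> set_pmf (c s)" using that M unfolding k enc_def by auto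
    hence "x \<in> set_pmf (map_pmf snd (c s))" by force
    thus "x \<in> seqs n" unfolding c(2) q_def using set_iid_subset_seqs by blast
  qed
  have code: "is_code n R enc h est"
    unfolding is_code_def M_def[symmetric] using M set_enc h
    by (auto simp: est_def M_def dest: subsetD[OF set_iid_subset_seqs])
  \<comment> \<open>Message and state are independent, so the state may be drawn first; message and
    input then come jointly from the coupling.\<close>
  have Q: "?Q = bind_pmf (iid n P) (\<lambda>s. bind_pmf (c (seq_map n fst s)) (\<lambda>w.
     bind_pmf (memoryless n W (snd w) s) (\<lambda>out.
       map_pmf (\<lambda>t. (fst w, h (seq_map n fst out), s, t)) (est (snd w) (seq_map n fst s) (seq_map n snd out)))))"
    unfolding code_law_def M_def[symmetric] k
    by (subst bind_commute_pmf) (simp add: bind_assoc_pmf bind_map_pmf enc_def map_pmf_def bind_return_pmf)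
  note Wout = memoryless_deterministic[where W = W and y = y and PZ = PZ, OF W]
  have error: "measure_pmf.prob ?Q {(m, m', s, t). m \<noteq> m'} \<le>
     measure_pmf.expectation (Pi_pmf {..<n} undefined (\<lambda>_. map_pmf fst P)) TV"
  proof -
    have err: "map_pmf (\<lambda>(m, m', s, t). m \<noteq> m') ?Q =
      bind_pmf (iid n P) (\<lambda>s. map_pmf (\<lambda>(m, x). m \<noteq> hx (seq_map n fst s) x) (c (seq_map n fst s)))"
    proof -
      have hh: "h (seq_map n fst (\<lambda>i\<in>{..<n}. (y (x i) (fst (s i)), z i))) = hx (seq_map n fst s) x"
        for x s and z :: "nat \<Rightarrow> 'z"
        unfolding hx_def by (intro arg_cong[of _ _ h]) (auto simp: seq_map_def fun_eq_iff)
      show ?thesis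
        unfolding Q Wout
        by (simp add: map_bind_pmf map_pmf_comp bind_map_pmf hh map_pmf_const)
           (simp add: map_pmf_def case_prod_unfold)
    qed
    have "measure_pmf.prob ?Q {(m, m', s, t). m \<noteq> m'} = pmf (map_pmf (\<lambda>(m, m', s, t). m \<noteq> m') ?Q) True"
      by (simp add: pmf_map vimage_def case_prod_unfold)
    also have "\<dots> = pmf (bind_pmf (iid n P)
       (\<lambda>s. map_pmf (\<lambda>(m, x). m \<noteq> hx (seq_map n fst s) x) (c (seq_map n fst s)))) True"
      unfolding err ..
    also have "\<dots> = measure_pmf.expectation (iid n P)
       (\<lambda>s. measure_pmf.prob (c (seq_map n fst s)) {(m, x). m \<noteq> hx (seq_map n fst s) x})"
      by (simp add: pmf_bind pmf_map vimage_def case_prod_unfold)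
    also have "\<dots> \<le> measure_pmf.expectation (iid n P) (\<lambda>s. TV (seq_map n fst s))"
      by (intro expectation_mono_pmf c(3)) (auto simp: iid_def intro!: finite_set_Pi_pmf)
    also have "\<dots> = measure_pmf.expectation (map_pmf (seq_map n fst) (iid n P)) TV"
      by simp
    finally show ?thesis unfolding iid_def map_seq_map_Pi_pmf .
  qed
  \<comment> \<open>The law of one estimate given its state letter. The same kernel describes the
    code, letter by letter, and the single-letter law, which transfers both the marginal and the
    distortion.\<close>
  define \<tau> where "\<tau> s = bind_pmf (PX (fst s)) (\<lambda>x.
     bind_pmf (PZ x (fst s) (snd s)) (\<lambda>z. PT x (fst s) z))" for s
  have st: "map_pmf (\<lambda>(m, m', s, t). (s, t)) ?Q =
     bind_pmf (iid n P) (\<lambda>s. map_pmf (Pair s) (Pi_pmf {..<n} undefined (\<lambda>i. \<tau> (s i))))"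
  proof -
    have "map_pmf (\<lambda>(m, m', s, t). (s, t)) ?Q = bind_pmf (iid n P) (\<lambda>s. map_pmf (Pair s)
       (bind_pmf (map_pmf snd (c (seq_map n fst s))) (\<lambda>x.
        bind_pmf (Pi_pmf {..<n} undefined (\<lambda>i. PZ (x i) (fst (s i)) (snd (s i)))) (\<lambda>z.
          est x (seq_map n fst s) (seq_map n snd (\<lambda>i\<in>{..<n}. (y (x i) (fst (s i)), z i)))))))"
      unfolding Q Wout by (simp add: map_bind_pmf map_pmf_comp bind_map_pmf)
    also have "\<dots> = bind_pmf (iid n P) (\<lambda>s. map_pmf (Pair s) (Pi_pmf {..<n} undefined (\<lambda>i. \<tau> (s i))))"
    proof (intro bind_pmf_cong arg_cong[of _ _ "map_pmf _"] refl)
      fix s :: "nat \<Rightarrow> 'e \<times> 'f"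
      have "est x (seq_map n fst s) (seq_map n snd (\<lambda>i\<in>{..<n}. (y (x i) (fst (s i)), z i))) =
         Pi_pmf {..<n} undefined (\<lambda>i. PT (x i) (fst (s i)) (z i))" for x z
        unfolding est_def by (intro Pi_pmf_cong) (auto simp: seq_map_def)
      moreover have "q (seq_map n fst s) = Pi_pmf {..<n} undefined (\<lambda>i. PX (fst (s i)))"
        unfolding q_def by (intro Pi_pmf_cong) (auto simp: seq_map_def)
      ultimately show "bind_pmf (map_pmf snd (c (seq_map n fst s))) (\<lambda>x.
        bind_pmf (Pi_pmf {..<n} undefined (\<lambda>i. PZ (x i) (fst (s i)) (snd (s i)))) (\<lambda>z.
          est x (seq_map n fst s) (seq_map n snd (\<lambda>i\<in>{..<n}. (y (x i) (fst (s i)), z i))))) =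
        Pi_pmf {..<n} undefined (\<lambda>i. \<tau> (s i))"
        unfolding c(2) \<tau>_def by (simp add: Pi_pmf_bind[where d' = undefined])
    qed
    finally show ?thesis .
  qed
  have R: "map_pmf (\<lambda>(x, se, sf, v, z, t). ((se, sf), t)) (joint_law P y PZ PX PT) =
     bind_pmf P (\<lambda>s. map_pmf (Pair s) (\<tau> s))"
    by (simp add: joint_law_def \<tau>_def map_pmf_def bind_assoc_pmf bind_return_pmf)
  have "bind_pmf P \<tau> = map_pmf snd (map_pmf (\<lambda>(x, se, sf, v, z, t). ((se, sf), t)) (joint_law P y PZ PX PT))"
    unfolding R by (simp add: map_bind_pmf map_pmf_comp)
  also have "\<dots> = P" unfolding map_pmf_comp using mT by (simp add: case_prod_unfold)
  finally have P\<tau>: "bind_pmf P \<tau> = P" .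
  have "map_pmf (\<lambda>(m, m', s, t). t) ?Q = map_pmf snd (map_pmf (\<lambda>(m, m', s, t). (s, t)) ?Q)"
    by (simp add: map_pmf_comp case_prod_unfold)
  also have "\<dots> = iid n P"
    unfolding st iid_def
    using Pi_pmf_bind[of "{..<n}" undefined "\<lambda>_. P" "\<lambda>_. \<tau>" undefined]
    by (simp add: map_bind_pmf map_pmf_comp P\<tau>)
  finally have marginal: "map_pmf (\<lambda>(m, m', s, t). t) ?Q = iid n P" .
  have "measure_pmf.expectation ?Q (\<lambda>(m, m', s, t). avg_distortion n d s t) =
       measure_pmf.expectation (joint_law P y PZ PX PT) (\<lambda>(x, se, sf, v, z, t). d (se, sf) t)"
  proof -
    let ?D = "bind_pmf P (\<lambda>s. map_pmf (Pair s) (\<tau> s))"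
    have "measure_pmf.expectation ?Q (\<lambda>(m, m', s, t). avg_distortion n d s t) =
      measure_pmf.expectation (map_pmf (\<lambda>(m, m', s, t). (s, t)) ?Q) (\<lambda>(s, t). avg_distortion n d s t)"
      by (simp add: case_prod_unfold)
    also have "\<dots> = measure_pmf.expectation (Pi_pmf {..<n} undefined (\<lambda>_. P)) (\<lambda>s.
      measure_pmf.expectation (Pi_pmf {..<n} undefined (\<lambda>i. \<tau> (s i))) (avg_distortion n d s))"
      unfolding st iid_def by (simp add: expectation_bind_pmf finite_set_Pi_pmf)
    also have "\<dots> = measure_pmf.expectation (Pi_pmf {..<n} undefined (\<lambda>_. ?D))
      (\<lambda>w. avg_distortion n d (seq_map n fst w) (seq_map n snd w))"
      by (rule expectation_iid_kernel)
    also have "\<dots> = measure_pmf.expectation (Pi_pmf {..<n} undefined (\<lambda>_. ?D))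
      (\<lambda>w. 1 / real n * (\<Sum>i<n. (\<lambda>(s, t). d s t) (w i)))"
      unfolding avg_distortion_def
      by (intro Bochner_Integration.integral_cong arg_cong[of _ _ "(*) _"] sum.cong refl)
         (simp add: seq_map_def case_prod_unfold)
    also have "\<dots> = 1 / real n * (\<Sum>i<n. measure_pmf.expectation ?D (\<lambda>(s, t). d s t))"
      by (subst integral_mult_right_zero, subst expectation_sum_finite)
         (auto simp: expectation_Pi_pmf_component intro!: finite_set_Pi_pmf)
    also have "\<dots> = measure_pmf.expectation ?D (\<lambda>(s, t). d s t)"
      using n by simp
    finally show ?thesis unfolding R[symmetric] by (simp add: case_prod_unfold)
  qed
  with code error marginal show ?thesis
    using that[of enc h est] unfolding TV_def M_def by blast
qed

lemma achievable_below_entropy: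
  fixes P :: "('e::finite \<times> 'f::finite) pmf"
    and W :: "'x::finite \<Rightarrow> 'e \<times> 'f \<Rightarrow> ('y::finite \<times> 'z::finite) pmf"
  assumes W: "\<And>x s. W x s = map_pmf (Pair (y x (fst s))) (PZ x (fst s) (snd s))"
    and mT: "map_pmf (\<lambda>(x, se, sf, v, z, t). t) (joint_law P y PZ PX PT) = P"
    and R: "0 \<le> R" "R = 0 \<or> R < output_entropy P y PX"
  shows "achievable P W d R (measure_pmf.expectation (joint_law P y PZ PX PT) (\<lambda>(x, se, sf, v, z, t). d (se, sf) t))"
  unfolding achievable_def
proof (intro allI impI)
  fix \<epsilon> :: real assume \<epsilon>: "0 < \<epsilon>"
  have "\<forall>\<^sub>F n in sequentially. \<exists>h. (\<forall>v. h v \<in> messages n R) \<and>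
     measure_pmf.expectation (Pi_pmf {..<n} undefined (\<lambda>_. map_pmf fst P))
       (\<lambda>s. total_variation (messages n R) (pmf_of_set (messages n R))
              (map_pmf h (Pi_pmf {..<n} undefined (\<lambda>i. output_law y PX (s i))))) \<le> \<epsilon>"
  proof (cases "R = 0")
    \<comment> \<open>With one message a constant hash has total variation 0. This covers an output
      entropy of 0, below which there is no nonnegative rate.\<close>
    case True
    have "messages n R = {1}" for n using True by (simp add: messages_eq)
    thus ?thesis using \<epsilon>
      by (auto intro!: always_eventually exI[of _ "\<lambda>_. 1"] simp: total_variation_def map_pmf_const pmf_of_set_singleton)
  next
    case False
    with R show ?thesis
      by (intro eventually_good_hash \<epsilon>) (auto simp: output_entropy_eq_expectation)
  qed
  moreover have "\<forall>\<^sub>F n::nat in sequentially. 0 < n" by (rule eventually_gt_at_top)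
  ultimately show "\<forall>\<^sub>F n in sequentially. \<exists>enc dec est. is_code n R enc dec est \<and>
     (let Q = code_law P W n R enc dec est in
        measure_pmf.prob Q {(m, m', s, t). m \<noteq> m'} \<le> \<epsilon> \<and>
        measure_pmf.expectation Q (\<lambda>(m, m', s, t). avg_distortion n d s t) \<le>
          measure_pmf.expectation (joint_law P y PZ PX PT) (\<lambda>(x, se, sf, v, z, t). d (se, sf) t) \<and>
        map_pmf (\<lambda>(m, m', s, t). t) Q = iid n P)"
  proof eventually_elim
    case (elim n)
    then obtain h where h: "\<And>v. h v \<in> messages n R"
      "measure_pmf.expectation (Pi_pmf {..<n} undefined (\<lambda>_. map_pmf fst P))
       (\<lambda>s. total_variation (messages n R) (pmf_of_set (messages n R))
              (map_pmf h (Pi_pmf {..<n} undefined (\<lambda>i. output_law y PX (s i))))) \<le> \<epsilon>" by blast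
    from code_from_hash[OF W elim(2) h(1) mT, where d = d] obtain enc dec est where
      "is_code n R enc dec est"
    "measure_pmf.prob (code_law P W n R enc dec est) {(m, m', s, t). m \<noteq> m'} \<le>
       measure_pmf.expectation (Pi_pmf {..<n} undefined (\<lambda>_. map_pmf fst P))
       (\<lambda>s. total_variation (messages n R) (pmf_of_set (messages n R))
              (map_pmf h (Pi_pmf {..<n} undefined (\<lambda>i. output_law y PX (s i)))))"
    "measure_pmf.expectation (code_law P W n R enc dec est) (\<lambda>(m, m', s, t). avg_distortion n d s t) =
       measure_pmf.expectation (joint_law P y PZ PX PT) (\<lambda>(x, se, sf, v, z, t). d (se, sf) t)"
    "map_pmf (\<lambda>(m, m', s, t). t) (code_law P W n R enc dec est) = iid n P" .
    thus ?case using h(2)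
      by (intro exI[of _ enc] exI[of _ dec] exI[of _ est]) (simp add: Let_def)
  qed
qed

section \<open>Converse\<close>

text \<open>The kernel \<open>k\<close> sees \<open>a\<close> only through \<open>g a\<close>, so
  for fixed \<open>z\<close> its probability is a constant on the event \<open>g a = x\<close>. This
  pulls the feedback probability, where the hidden state component of the letter enters, out of the
  average over the rest of the block.\<close>

lemma pmf_bind_observed:
  fixes k :: "'x \<Rightarrow> 'z::finite pmf"
  shows "pmf (bind_pmf A (\<lambda>a. bind_pmf (k (g a)) (\<lambda>z. map_pmf (\<lambda>b. (g a, z, b)) (B a z)))) (x, z, t) =
    pmf (k x) z * pmf (bind_pmf A (\<lambda>a. map_pmf (Pair (g a)) (B a z))) (x, t)"
proof -
  have "pmf (bind_pmf (k (g a)) (\<lambda>z. map_pmf (\<lambda>b. (g a, z, b)) (B a z))) (x, z, t) =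
    pmf (k x) z * pmf (map_pmf (Pair (g a)) (B a z)) (x, t)" for a
  proof -
    have *: "pmf (map_pmf (\<lambda>b. (g a, z', b)) (B a z')) (x, z, t) =
       of_bool (g a = x) * (of_bool (z' = z) * pmf (B a z') t)" for z'
      using pmf_map_Pair[of "g a" "map_pmf (Pair z') (B a z')" x "(z, t)"]
      by (simp add: map_pmf_comp pmf_map_Pair)
    show ?thesis
      unfolding pmf_bind_finite * pmf_map_Pair
      by (subst sum_UNIV_single[where c = z]) auto
  qed
  thus ?thesis by (simp add: pmf_bind)
qed

text \<open>Retains the input and the feedback, which \<open>code_law\<close> discards and the
  single-letter argument needs. The output is a function of input and state and is left
  implicit.\<close>

definition transmission_law ::
    "('e \<times> 'f) pmf \<Rightarrow> ('x \<Rightarrow> 'e \<Rightarrow> 'f \<Rightarrow> 'z pmf) \<Rightarrow> nat \<Rightarrow> 'm set \<Rightarrow>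
     ('m \<Rightarrow> (nat \<Rightarrow> 'e) \<Rightarrow> (nat \<Rightarrow> 'x) pmf) \<Rightarrow>
     ((nat \<Rightarrow> 'x) \<Rightarrow> (nat \<Rightarrow> 'e) \<Rightarrow> (nat \<Rightarrow> 'z) \<Rightarrow> (nat \<Rightarrow> 't) pmf) \<Rightarrow>
     ('m \<times> (nat \<Rightarrow> 'e \<times> 'f) \<times> (nat \<Rightarrow> 'x) \<times> (nat \<Rightarrow> 'z) \<times> (nat \<Rightarrow> 't)) pmf" where
  "transmission_law P PZ n M enc est =
     do {
       m \<leftarrow> pmf_of_set M;
       s \<leftarrow> Pi_pmf {..<n} undefined (\<lambda>_. P);
       x \<leftarrow> enc m (seq_map n fst s);
       z \<leftarrow> Pi_pmf {..<n} undefined (\<lambda>i. PZ (x i) (fst (s i)) (snd (s i)));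
       t \<leftarrow> est x (seq_map n fst s) z;
       return_pmf (m, s, x, z, t)
     }"

lemma code_law_eq_transmission:
  assumes W: "\<And>x s. W x s = map_pmf (Pair (y x (fst s))) (PZ x (fst s) (snd s))"
  shows "code_law P W n R enc dec est =
    map_pmf (\<lambda>(m, s, x, z, t). (m, dec (\<lambda>i\<in>{..<n}. y (x i) (fst (s i))), s, t))
      (transmission_law P PZ n (messages n R) enc est)"
  unfolding code_law_def transmission_law_def memoryless_deterministic[where W = W and y = y and PZ = PZ, OF W] map_bind_pmf bind_map_pmf
    map_return_pmf prod.case iid_def
proof (intro bind_pmf_cong refl)
  fix s x z assume "z \<in> set_pmf (Pi_pmf {..<n} undefined (\<lambda>i. PZ (x i) (fst (s i)) (snd (s i))))"
  \<comment> \<open>Reading the feedback back from the output pairs returns \<open>z\<close> itself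
    because \<open>z\<close> is \<open>undefined\<close> outside \<open>{..<n}\<close>.\<close>
  hence "z \<in> seqs n" using set_iid_subset_seqs by blast
  thus "est x (seq_map n fst s) (seq_map n snd (\<lambda>i\<in>{..<n}. (y (x i) (fst (s i)), z i))) = est x (seq_map n fst s) z"
    by (intro arg_cong[of _ _ "est x (seq_map n fst s)"])
       (auto simp: seq_map_def seqs_def fun_eq_iff PiE_def extensional_def)
next
  fix m x s z t
  have "seq_map n fst (\<lambda>i\<in>{..<n}. (y (x i) (fst (s i)), z i)) = (\<lambda>i\<in>{..<n}. y (x i) (fst (s i)))"
    by (auto simp: seq_map_def fun_eq_iff)
  thus "return_pmf (m, dec (seq_map n fst (\<lambda>i\<in>{..<n}. (y (x i) (fst (s i)), z i))), s, t) =
     return_pmf (m, dec (\<lambda>i\<in>{..<n}. y (x i) (fst (s i))), s, t)" by simp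
qed

text \<open>
  Here \<open>\<Gamma> e z\<close> is the law of \<open>(x i, t i)\<close> when the values \<open>fst (s i) = e\<close> and \<open>z i = z\<close> are
  imposed. The input is chosen before the feedback, so its first marginal does not depend on \<open>z\<close>.
\<close>

lemma transmission_law_component:
  fixes P :: "('e::finite \<times> 'f::finite) pmf" and PZ :: "'x \<Rightarrow> 'e \<Rightarrow> 'f \<Rightarrow> 'z::finite pmf"
    and est :: "(nat \<Rightarrow> 'x) \<Rightarrow> (nat \<Rightarrow> 'e) \<Rightarrow> (nat \<Rightarrow> 'z) \<Rightarrow> (nat \<Rightarrow> 't) pmf"
  assumes i: "i < n"
  obtains \<xi> \<Gamma> where "\<And>e z. map_pmf fst (\<Gamma> e z) = \<xi> e"
    "\<And>s x z t. pmf (map_pmf (\<lambda>(m, s, x, z, t). (s i, x i, z i, t i)) (transmission_law P PZ n M enc est)) (s, x, z, t) =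
        pmf P s * (pmf (PZ x (fst s) (snd s)) z * pmf (\<Gamma> (fst s) z) (x, t))"
proof -
  let ?I = "{..<n} - {i}"
  define PS where "PS = Pi_pmf ?I undefined (\<lambda>_. P)"
  define PZ' where "PZ' x s = Pi_pmf ?I undefined (\<lambda>j. PZ (x j) (fst (s j)) (snd (s j)))"
    for x and s :: "nat \<Rightarrow> 'e \<times> 'f"
  \<comment> \<open>The other state letters and the whole input, with \<open>e\<close> written into
    position \<open>i\<close> before encoding. Encoder and estimator see the state letter only
    through \<open>e\<close>, so neither \<open>A\<close> nor \<open>B\<close> depends on its second
    component.\<close>
  define A where "A e = bind_pmf (pmf_of_set M) (\<lambda>m. bind_pmf PS (\<lambda>s.
      map_pmf (Pair s) (enc m ((seq_map n fst s)(i := e)))))" for e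
  define B where "B e w z = bind_pmf (PZ' (snd w) (fst w)) (\<lambda>z'.
      map_pmf (\<lambda>t. t i) (est (snd w) ((seq_map n fst (fst w))(i := e)) (z'(i := z))))"
    for e w z
  define \<Gamma> where "\<Gamma> e z = bind_pmf (A e) (\<lambda>w. map_pmf (Pair (snd w i)) (B e w z))" for e z
  have "map_pmf fst (\<Gamma> e z) = map_pmf (\<lambda>w. snd w i) (A e)" for e z
    by (simp add: \<Gamma>_def map_bind_pmf map_pmf_comp map_pmf_const) (simp add: map_pmf_def)
  moreover have "pmf (map_pmf (\<lambda>(m, s, x, z, t). (s i, x i, z i, t i)) (transmission_law P PZ n M enc est)) (s, x, z, t) =
        pmf P s * (pmf (PZ x (fst s) (snd s)) z * pmf (\<Gamma> (fst s) z) (x, t))" for s x z t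
  proof -
    have ins: "{..<n} = insert i ?I" using i by auto
    have S: "Pi_pmf {..<n} undefined (\<lambda>_. P) = bind_pmf P (\<lambda>s0. map_pmf (\<lambda>s. s(i := s0)) PS)"
      unfolding PS_def by (subst ins, subst Pi_pmf_insert') (auto simp: map_pmf_def)
    have Z: "Pi_pmf {..<n} undefined (\<lambda>j. PZ (x j) (fst ((s(i := s0)) j)) (snd ((s(i := s0)) j))) =
      bind_pmf (PZ (x i) (fst s0) (snd s0)) (\<lambda>z0. map_pmf (\<lambda>z. z(i := z0)) (PZ' x s))" for x s s0
    proof -
      have "Pi_pmf ?I undefined (\<lambda>j. PZ (x j) (fst ((s(i := s0)) j)) (snd ((s(i := s0)) j))) = PZ' x s"
        unfolding PZ'_def by (intro Pi_pmf_cong) auto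
      thus ?thesis
        by (subst ins, subst Pi_pmf_insert') (auto simp: map_pmf_def)
    qed
    have E: "seq_map n fst (s(i := s0)) = (seq_map n fst s)(i := fst s0)" for s :: "nat \<Rightarrow> 'e \<times> 'f" and s0
      using i by (auto simp: seq_map_def fun_eq_iff)
    have "map_pmf (\<lambda>(m, s, x, z, t). (s i, x i, z i, t i)) (transmission_law P PZ n M enc est) =
      bind_pmf (pmf_of_set M) (\<lambda>m. bind_pmf P (\<lambda>s0. bind_pmf PS (\<lambda>s. bind_pmf (enc m ((seq_map n fst s)(i := fst s0)))
       (\<lambda>x. bind_pmf (PZ (x i) (fst s0) (snd s0)) (\<lambda>z0. map_pmf (\<lambda>b. (s0, x i, z0, b)) (B (fst s0) (s, x) z0))))))"
      unfolding transmission_law_def S bind_assoc_pmf bind_map_pmf Z E B_def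
      by (simp add: map_bind_pmf map_pmf_comp bind_assoc_pmf bind_map_pmf) (simp add: map_pmf_def)
    also have "\<dots> = bind_pmf P (\<lambda>s0. map_pmf (Pair s0) (bind_pmf (A (fst s0)) (\<lambda>w.
       bind_pmf (PZ (snd w i) (fst s0) (snd s0)) (\<lambda>z0. map_pmf (\<lambda>b. (snd w i, z0, b)) (B (fst s0) w z0)))))"
      unfolding A_def
      by (subst bind_commute_pmf) (simp add: map_bind_pmf map_pmf_comp bind_assoc_pmf bind_map_pmf)
    finally have eq: "map_pmf (\<lambda>(m, s, x, z, t). (s i, x i, z i, t i)) (transmission_law P PZ n M enc est) = \<dots>" .
    show ?thesis
      unfolding eq pmf_bind_finite pmf_map_Pair \<Gamma>_def
        pmf_bind_observed[of _ "\<lambda>x. PZ x _ _" "\<lambda>w. snd w i"]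
      by (subst sum_UNIV_single[where c = s]) auto
  qed
  ultimately show ?thesis using that[of \<Gamma> "\<lambda>e. map_pmf (\<lambda>w. snd w i) (A e)"] by blast
qed

text \<open>A uniform letter index mixes the laws. Source and feedback channel are the same at every
  letter, so only \<open>\<Gamma>\<close> is mixed, and the input marginal of the mixture still does
  not depend on \<open>z\<close>; this makes \<open>PX\<close> an input kernel that ignores the
  feedback. Arbitrary \<open>\<phi>\<close> lets one law serve the marginal, the distortion and the
  entropy.\<close>

lemma single_letterization:
  fixes P :: "('e::finite \<times> 'f::finite) pmf" and PZ :: "'x::finite \<Rightarrow> 'e \<Rightarrow> 'f \<Rightarrow> 'z::finite pmf"
    and est :: "(nat \<Rightarrow> 'x) \<Rightarrow> (nat \<Rightarrow> 'e) \<Rightarrow> (nat \<Rightarrow> 'z) \<Rightarrow> (nat \<Rightarrow> 'e \<times> 'f) pmf"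
  assumes n: "0 < n" and fin: "finite (set_pmf (transmission_law P PZ n M enc est))"
  obtains PX PT where "\<And>\<phi> :: _ \<Rightarrow> _ \<Rightarrow> _ \<Rightarrow> real.
    measure_pmf.expectation (joint_law P y PZ PX PT) (\<lambda>(x, se, sf, v, z, t). \<phi> (se, sf) x t) =
    measure_pmf.expectation (transmission_law P PZ n M enc est) (\<lambda>(m, s, x, z, t). \<Sum>i<n. \<phi> (s i) (x i) (t i)) / real n"
proof -
  let ?T = "transmission_law P PZ n M enc est"
  define L where "L i = map_pmf (\<lambda>(m, s, x, z, t). (s i, x i, z i, t i)) ?T" for i
  have "\<exists>\<xi> \<Gamma>. i < n \<longrightarrow> (\<forall>e z. map_pmf fst (\<Gamma> e z) = \<xi> e) \<and>
    (\<forall>s x z t. pmf (L i) (s, x, z, t) = pmf P s * (pmf (PZ x (fst s) (snd s)) z * pmf (\<Gamma> (fst s) z) (x, t)))" for i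
    unfolding L_def using transmission_law_component[of i n P PZ M enc est] by metis
  then obtain \<xi> \<Gamma> where \<xi>: "\<And>i e z. i < n \<Longrightarrow> map_pmf fst (\<Gamma> i e z) = \<xi> i e"
    and \<Gamma>: "\<And>i s x z t. i < n \<Longrightarrow> pmf (L i) (s, x, z, t) = pmf P s * (pmf (PZ x (fst s) (snd s)) z * pmf (\<Gamma> i (fst s) z) (x, t))"
    by metis
  define U where "U = pmf_of_set {..<n}"
  have U: "set_pmf U = {..<n}" using n by (auto simp: U_def intro!: set_pmf_of_set)
  define PX where "PX e = bind_pmf U (\<lambda>i. \<xi> i e)" for e
  have "\<exists>k. \<forall>x t. pmf (bind_pmf U (\<lambda>i. \<Gamma> i e z)) (x, t) = pmf (PX e) x * pmf (k x) t" for e z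
  proof -
    have "map_pmf fst (bind_pmf U (\<lambda>i. \<Gamma> i e z)) = PX e"
      unfolding map_bind_pmf PX_def using U \<xi> by (intro bind_pmf_cong) auto
    thus ?thesis using pmf_disintegration[of "bind_pmf U (\<lambda>i. \<Gamma> i e z)"] by metis
  qed
  then obtain k where k: "\<And>e z x t. pmf (bind_pmf U (\<lambda>i. \<Gamma> i e z)) (x, t) = pmf (PX e) x * pmf (k e z x) t"
    by metis
  define PT where "PT x e z = k e z x" for x e z
  have "map_pmf (\<lambda>(x, se, sf, v, z, t). ((se, sf), x, z, t)) (joint_law P y PZ PX PT) = bind_pmf U L"
  proof (rule pmf_eqI)
    fix w :: "('e \<times> 'f) \<times> 'x \<times> 'z \<times> ('e \<times> 'f)"
    obtain s x z t where w: "w = (s, x, z, t)" by (cases w) auto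
    have "pmf (bind_pmf U L) w = pmf P s * (pmf (PZ x (fst s) (snd s)) z * pmf (bind_pmf U (\<lambda>i. \<Gamma> i (fst s) z)) (x, t))"
      using n \<Gamma> unfolding w U_def
      by (simp add: pmf_bind_pmf_of_set lessThan_empty_iff sum_distrib_left sum_divide_distrib)
    moreover have "map_pmf (\<lambda>(x, se, sf, v, z, t). ((se, sf), x, z, t)) (joint_law P y PZ PX PT) =
      bind_pmf P (\<lambda>s. map_pmf (Pair s) (bind_pmf (PX (fst s)) (\<lambda>x. map_pmf (Pair x)
        (bind_pmf (PZ x (fst s) (snd s)) (\<lambda>z. map_pmf (Pair z) (PT x (fst s) z))))))"
      by (simp add: joint_law_def map_pmf_def bind_assoc_pmf bind_return_pmf)
    hence "pmf (map_pmf (\<lambda>(x, se, sf, v, z, t). ((se, sf), x, z, t)) (joint_law P y PZ PX PT)) w =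
      pmf P s * (pmf (PX (fst s)) x * (pmf (PZ x (fst s) (snd s)) z * pmf (PT x (fst s) z) t))"
      unfolding w by (simp add: pmf_bind_map_Pair)
    ultimately show "pmf (map_pmf (\<lambda>(x, se, sf, v, z, t). ((se, sf), x, z, t)) (joint_law P y PZ PX PT)) w =
       pmf (bind_pmf U L) w"
      by (simp add: k PT_def)
  qed
  note LJ = this
  have "measure_pmf.expectation (joint_law P y PZ PX PT) (\<lambda>(x, se, sf, v, z, t). \<phi> (se, sf) x t) =
    measure_pmf.expectation ?T (\<lambda>(m, s, x, z, t). \<Sum>i<n. \<phi> (s i) (x i) (t i)) / real n"
    for \<phi> :: "'e \<times> 'f \<Rightarrow> 'x \<Rightarrow> 'e \<times> 'f \<Rightarrow> real"
  proof -
    have "measure_pmf.expectation (joint_law P y PZ PX PT) (\<lambda>(x, se, sf, v, z, t). \<phi> (se, sf) x t) =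
      measure_pmf.expectation (bind_pmf U L) (\<lambda>(s, x, z, t). \<phi> s x t)"
      unfolding LJ[symmetric] by (simp add: case_prod_unfold)
    also have "\<dots> = (\<Sum>i<n. measure_pmf.expectation (L i) (\<lambda>(s, x, z, t). \<phi> s x t)) / real n"
      unfolding U_def using n fin
      by (subst pmf_expectation_bind_pmf_of_set) (auto simp: L_def sum_divide_distrib divide_inverse lessThan_empty_iff mult.commute sum_distrib_left)
    also have "(\<Sum>i<n. measure_pmf.expectation (L i) (\<lambda>(s, x, z, t). \<phi> s x t)) =
      measure_pmf.expectation ?T (\<lambda>(m, s, x, z, t). \<Sum>i<n. \<phi> (s i) (x i) (t i))"
      unfolding case_prod_unfold expectation_sum_finite[OF fin] by (simp add: L_def case_prod_unfold)
    finally show ?thesis .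
  qed
  thus ?thesis using that by blast
qed

text \<open>Writes the entropy as the mean of a function of state letter and input, to which
  \<open>single_letterization\<close> applies.\<close>

lemma output_entropy_joint_law:
  fixes P :: "('e::finite \<times> 'f::finite) pmf" and PZ :: "'x::finite \<Rightarrow> 'e \<Rightarrow> 'f \<Rightarrow> 'z::finite pmf"
    and y :: "'x \<Rightarrow> 'e \<Rightarrow> 'y::finite"
  shows "output_entropy P y PX = measure_pmf.expectation (joint_law P y PZ PX PT)
    (\<lambda>(x, se, sf, v, z, t). - log 2 (pmf (output_law y PX se) (y x se)))"
proof -
  have "map_pmf (\<lambda>(x, se, sf, v, z, t). (se, y x se)) (joint_law P y PZ PX PT) =
     bind_pmf (map_pmf fst P) (\<lambda>e. map_pmf (Pair e) (output_law y PX e))"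
    by (simp add: joint_law_def output_law_def map_pmf_def bind_assoc_pmf bind_return_pmf)
  hence "output_entropy P y PX = measure_pmf.expectation
     (map_pmf (\<lambda>(x, se, sf, v, z, t). (se, y x se)) (joint_law P y PZ PX PT))
     (\<lambda>(e, v). - log 2 (pmf (output_law y PX e) v))"
    by (simp only: output_entropy_eq_expectation)
  thus ?thesis by (simp add: case_prod_unfold)
qed

section \<open>Gibbs' inequality and the rate of one code\<close>

lemma expectation_le_sum:
  fixes g :: "'b \<Rightarrow> real"
  assumes "finite A" "\<And>x. x \<in> set_pmf p \<Longrightarrow> f x \<in> A" "\<And>a. a \<in> A \<Longrightarrow> 0 \<le> g a"
  shows "measure_pmf.expectation p (\<lambda>x. g (f x)) \<le> (\<Sum>a\<in>A. g a)"
proof -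
  have "measure_pmf.expectation p (\<lambda>x. g (f x)) = measure_pmf.expectation (map_pmf f p) g"
    by simp
  also have "\<dots> = (\<Sum>a\<in>A. pmf (map_pmf f p) a * g a)"
    using assms by (subst integral_measure_pmf[of A]) auto
  also have "\<dots> \<le> (\<Sum>a\<in>A. 1 * g a)"
    using assms by (intro sum_mono mult_right_mono pmf_le_1) auto
  finally show ?thesis by simp
qed

lemma finite_seqs [simp]: "finite (seqs n :: (nat \<Rightarrow> 'a::finite) set)"
  by (simp add: seqs_def finite_PiE)

text \<open>
  Gibbs' inequality against the sub-probability weights \<open>q\<^sup>n(v | s) w(m | v)\<close>, where \<open>w\<close> puts half of
  its mass on the decoded message and spreads the other half uniformly. It combines Fano's inequality
  with the subadditivity of conditional entropy.
\<close>

lemma entropy_converse: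
  fixes P :: "('e::finite \<times> 'f::finite) pmf" and PZ :: "'x::finite \<Rightarrow> 'e \<Rightarrow> 'f \<Rightarrow> 'z::finite pmf"
    and est :: "(nat \<Rightarrow> 'x) \<Rightarrow> (nat \<Rightarrow> 'e) \<Rightarrow> (nat \<Rightarrow> 'z) \<Rightarrow> (nat \<Rightarrow> 't) pmf"
    and y :: "'x \<Rightarrow> 'e \<Rightarrow> 'v::finite" and dec :: "(nat \<Rightarrow> 'v) \<Rightarrow> 'm"
    and enc :: "'m \<Rightarrow> (nat \<Rightarrow> 'e) \<Rightarrow> (nat \<Rightarrow> 'x) pmf" and M :: "'m set" and n :: nat
    and q :: "'e \<Rightarrow> 'v pmf"
  defines "T \<equiv> transmission_law P PZ n M enc est"
    and "out \<equiv> \<lambda>s x. \<lambda>i\<in>{..<n}. y (x i) (fst (s i))"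
  assumes M: "finite M" "M \<noteq> {}" and fT: "finite (set_pmf T)"
    and enc: "\<And>m s. m \<in> M \<Longrightarrow> s \<in> seqs n \<Longrightarrow> finite (set_pmf (enc m s))"
    and dec: "\<And>v. v \<in> seqs n \<Longrightarrow> dec v \<in> M"
    and pos: "\<And>m s x z t i. (m, s, x, z, t) \<in> set_pmf T \<Longrightarrow> i < n \<Longrightarrow> 0 < pmf (q (fst (s i))) (y (x i) (fst (s i)))"
  shows "ln (card M) - ln 2 - measure_pmf.expectation T (\<lambda>(m, s, x, z, t). of_bool (m \<noteq> dec (out s x))) * ln (card M)
    \<le> measure_pmf.expectation T (\<lambda>(m, s, x, z, t). \<Sum>i<n. - ln (pmf (q (fst (s i))) (y (x i) (fst (s i)))))"
proof -
  define K where "K = real (card M)"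
  have K: "1 \<le> K" using M by (simp add: K_def Suc_le_eq card_gt_0_iff)
  define w where "w m v = (of_bool (m = dec v) + 1 / K) / 2" for m v
  \<comment> \<open>The test weight divided by the probability \<open>1 / K\<close> of the
    message.\<close>
  define G where "G m s v = K * (\<Prod>i<n. pmf (q (fst (s i))) (v i)) * w m v" for m and s :: "nat \<Rightarrow> 'e \<times> 'f" and v
  have w0: "0 < w m v" for m v using K by (auto simp: w_def intro!: add_nonneg_pos)
  have wsum: "(\<Sum>m\<in>M. w m v) = 1" if "v \<in> seqs n" for v
  proof -
    have "(\<Sum>m\<in>M. w m v) = ((\<Sum>m\<in>M. of_bool (m = dec v)) + K * (1 / K)) / 2"
      by (simp add: w_def K_def sum.distrib flip: sum_divide_distrib)
    also have "(\<Sum>m\<in>M. of_bool (m = dec v)) = (1::real)"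
      using M dec[OF that] by (simp add: of_bool_def sum.delta)
    finally show ?thesis using K by simp
  qed
  have G0: "0 \<le> G m s v" for m s v using w0[of m v] K by (auto simp: G_def intro!: mult_nonneg_nonneg prod_nonneg)
  have Gsum: "(\<Sum>m\<in>M. \<Sum>v\<in>seqs n. G m s v) / K = 1" for s
  proof -
    have "(\<Sum>m\<in>M. \<Sum>v\<in>seqs n. G m s v) / K = (\<Sum>v\<in>seqs n. (\<Prod>i<n. pmf (q (fst (s i))) (v i)) * (\<Sum>m\<in>M. w m v))"
      using K by (subst sum.swap) (simp add: G_def sum_divide_distrib sum_distrib_left mult.assoc)
    also have "\<dots> = (\<Sum>v\<in>seqs n. pmf (Pi_pmf {..<n} undefined (\<lambda>i. q (fst (s i)))) v)"
      by (intro sum.cong refl, subst pmf_Pi') (auto simp: wsum seqs_def PiE_def extensional_def)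
    also have "\<dots> = 1"
      by (intro sum_pmf_eq_1 finite_seqs set_iid_subset_seqs)
    finally show ?thesis .
  qed
  let ?m = "pmf_of_set M" and ?s = "Pi_pmf {..<n} undefined (\<lambda>_. P)"
  have fs: "finite (set_pmf ?s)" by (auto intro: finite_set_Pi_pmf)
  have fm: "finite (set_pmf ?m)" and sm: "set_pmf ?m = M" using M by auto
  have sseq: "seq_map n fst s \<in> seqs n" for s :: "nat \<Rightarrow> 'e \<times> 'f"
    by (auto simp: seq_map_def seqs_def)
  have outseq: "out s x \<in> seqs n" for s x by (auto simp: out_def seqs_def)
  have le1: "measure_pmf.expectation T (\<lambda>(m, s, x, z, t). G m s (out s x)) \<le> 1"
  proof -
    have marg: "map_pmf (\<lambda>(m, s, x, z, t). (m, s, x)) T = bind_pmf ?m (\<lambda>m. bind_pmf ?s (\<lambda>s.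
        map_pmf (\<lambda>x. (m, s, x)) (enc m (seq_map n fst s))))"
      unfolding T_def transmission_law_def by (simp add: map_bind_pmf) (simp add: map_pmf_def)
    have "measure_pmf.expectation T (\<lambda>(m, s, x, z, t). G m s (out s x)) =
      measure_pmf.expectation (map_pmf (\<lambda>(m, s, x, z, t). (m, s, x)) T) (\<lambda>(m, s, x). G m s (out s x))"
      by (simp add: case_prod_unfold)
    also have "\<dots> = measure_pmf.expectation ?m (\<lambda>m. measure_pmf.expectation ?s (\<lambda>s.
       measure_pmf.expectation (enc m (seq_map n fst s)) (\<lambda>x. G m s (out s x))))"
    proof -
      have "measure_pmf.expectation (bind_pmf ?s (\<lambda>s. map_pmf (\<lambda>x. (m, s, x)) (enc m (seq_map n fst s)))) (\<lambda>(m, s, x). G m s (out s x)) =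
        measure_pmf.expectation ?s (\<lambda>s. measure_pmf.expectation (enc m (seq_map n fst s)) (\<lambda>x. G m s (out s x)))"
        if "m \<in> M" for m
        using fs enc[OF that sseq] by (subst expectation_bind_pmf) auto
      thus ?thesis
        unfolding marg using fm fs enc sseq
        by (subst expectation_bind_pmf) (auto simp: sm intro!: Bochner_Integration.integral_cong_AE AE_pmfI)
    qed
    \<comment> \<open>Bounding the law of the output given message and state by 1 amounts to
      dropping the nonnegative conditional entropy of the output given both.\<close>
    also have "\<dots> \<le> measure_pmf.expectation ?m (\<lambda>m. measure_pmf.expectation ?s (\<lambda>s. \<Sum>v\<in>seqs n. G m s v))"
      using fm fs by (intro expectation_mono_pmf expectation_le_sum outseq G0 finite_seqs) auto
    also have "\<dots> = measure_pmf.expectation ?s (\<lambda>s. measure_pmf.expectation ?m (\<lambda>m. \<Sum>v\<in>seqs n. G m s v))"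
      using fm fs by (rule expectation_commute)
    also have "\<dots> = 1"
      using M Gsum by (simp add: integral_pmf_of_set K_def)
    finally show ?thesis .
  qed
  have int: "integrable (measure_pmf T) f" for f :: "_ \<Rightarrow> real"
    using fT by (rule integrable_measure_pmf_finite)
  let ?err = "\<lambda>(m, s, x, z :: nat \<Rightarrow> 'z, t :: nat \<Rightarrow> 't). of_bool (m \<noteq> dec (out s x)) :: real"
  let ?f = "\<lambda>(m, s :: nat \<Rightarrow> 'e \<times> 'f, x, z :: nat \<Rightarrow> 'z, t :: nat \<Rightarrow> 't). \<Sum>i<n. - ln (pmf (q (fst (s i))) (y (x i) (fst (s i))))"
  have "measure_pmf.expectation T (\<lambda>u. ln K - ?f u - ln 2 - ln K * ?err u) \<le>
    measure_pmf.expectation T (\<lambda>u. (case u of (m, s, x, z, t) \<Rightarrow> G m s (out s x)) - 1)"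
  proof (intro expectation_mono_pmf fT)
    fix u assume u: "u \<in> set_pmf T"
    obtain m s x z t where ut: "u = (m, s, x, z, t)" by (cases u) auto
    have p: "0 < pmf (q (fst (s i))) (y (x i) (fst (s i)))" if "i < n" for i using pos u that unfolding ut by blast
    have pr: "(\<Prod>i<n. pmf (q (fst (s i))) (out s x i)) = (\<Prod>i<n. pmf (q (fst (s i))) (y (x i) (fst (s i))))"
      by (intro prod.cong) (auto simp: out_def)
    have prp: "0 < (\<Prod>i<n. pmf (q (fst (s i))) (y (x i) (fst (s i))))" using p by (intro prod_pos) auto
    \<comment> \<open>A correct decision has weight at least 1/2 and an error has weight
      \<open>1 / (2 * K)\<close>; these give the two terms of Fano's inequality.\<close>
    have "- ln 2 - ln K * ?err u \<le> ln (w m (out s x))"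
    proof (cases "m = dec (out s x)")
      case True
      have "ln (1 / 2) \<le> ln (w m (out s x))" using True K by (subst ln_le_cancel_iff) (auto simp: w_def intro!: add_pos_pos)
      thus ?thesis using True by (simp add: ut ln_div)
    next
      case False
      thus ?thesis using K by (simp add: ut w_def ln_div ln_mult)
    qed
    moreover have "ln (\<Prod>i<n. pmf (q (fst (s i))) (y (x i) (fst (s i)))) = (\<Sum>i<n. ln (pmf (q (fst (s i))) (y (x i) (fst (s i)))))"
      using p by (intro ln_prod) (force simp: less_le)+
    moreover have "ln (K * c * w m (out s x)) = ln K + ln c + ln (w m (out s x))" if "0 < c" for c
      using that K w0[of m "out s x"] by (simp add: ln_mult)
    from this[OF prp] have "ln (G m s (out s x)) =
        ln K + ln (\<Prod>i<n. pmf (q (fst (s i))) (y (x i) (fst (s i)))) + ln (w m (out s x))"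
      unfolding G_def pr .
    ultimately have "ln (G m s (out s x)) \<ge> ln K - ?f u - ln 2 - ln K * ?err u"
      by (simp add: ut sum_negf)
    moreover have "0 < G m s (out s x)" using K prp w0 unfolding G_def pr by simp
    hence "ln (G m s (out s x)) \<le> G m s (out s x) - 1" by (rule ln_le_minus_one)
    ultimately show "ln K - ?f u - ln 2 - ln K * ?err u \<le> (case u of (m, s, x, z, t) \<Rightarrow> G m s (out s x)) - 1"
      by (simp add: ut)
  qed
  also have "\<dots> = measure_pmf.expectation T (\<lambda>(m, s, x, z, t). G m s (out s x)) - 1"
    by (subst Bochner_Integration.integral_diff) (auto simp: int)
  also have "\<dots> \<le> 0" using le1 by simp
  also have "measure_pmf.expectation T (\<lambda>u. ln K - ?f u - ln 2 - ln K * ?err u) =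
     ln K - measure_pmf.expectation T ?f - ln 2 - ln K * measure_pmf.expectation T ?err"
    by (simp add: int del: Bochner_Integration.integral_sum)
  finally show ?thesis by (simp add: K_def mult.commute)
qed

lemma set_transmission_law_subset:
  assumes M: "finite M" "M \<noteq> {}"
    and enc: "\<And>m s. m \<in> M \<Longrightarrow> s \<in> seqs n \<Longrightarrow> set_pmf (enc m s) \<subseteq> seqs n"
    and est: "\<And>x s z. x \<in> seqs n \<Longrightarrow> s \<in> seqs n \<Longrightarrow> z \<in> seqs n \<Longrightarrow> set_pmf (est x s z) \<subseteq> seqs n"
  shows "set_pmf (transmission_law P PZ n M enc est) \<subseteq> M \<times> seqs n \<times> seqs n \<times> seqs n \<times> seqs n"
proof
  fix u assume u: "u \<in> set_pmf (transmission_law P PZ n M enc est)"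
  obtain m s x z t where ut: "u = (m, s, x, z, t)" by (cases u) auto
  have *: "m \<in> M" "s \<in> set_pmf (Pi_pmf {..<n} undefined (\<lambda>_. P))" "x \<in> set_pmf (enc m (seq_map n fst s))"
    "z \<in> set_pmf (Pi_pmf {..<n} undefined (\<lambda>i. PZ (x i) (fst (s i)) (snd (s i))))"
    "t \<in> set_pmf (est x (seq_map n fst s) z)"
    using u M unfolding ut transmission_law_def by auto
  have sq: "seq_map n fst s \<in> seqs n" by (auto simp: seq_map_def seqs_def)
  have "s \<in> seqs n" "z \<in> seqs n" using *(2,4) set_iid_subset_seqs by blast+
  moreover have "x \<in> seqs n" using enc[OF *(1) sq] *(3) by blast
  moreover have "t \<in> seqs n" using est[OF \<open>x \<in> seqs n\<close> sq \<open>z \<in> seqs n\<close>] *(5) by blast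
  ultimately show "u \<in> M \<times> seqs n \<times> seqs n \<times> seqs n \<times> seqs n" using *(1) ut by simp
qed

text \<open>Rounding down costs at most one bit: once there is a message, the number of messages
  plus one is at most twice that number.\<close>

lemma half_powr_le_card_messages:
  assumes "messages n R \<noteq> {}"
  shows "2 powr (real n * R) / 2 \<le> real (card (messages n R))"
proof -
  have "real (card (messages n R)) \<ge> 1"
    using assms by (simp add: Suc_le_eq card_gt_0_iff)
  moreover have "2 powr (real n * R) < real (card (messages n R)) + 1"
    unfolding card_messages by linarith
  ultimately show ?thesis by linarith
qed

text \<open>The loss \<open>2 / real n\<close> is two bits per block: one from rounding the number
  of messages, one from the half weight on the decoded message. The marginal is exact because every
  letter of the estimate has law \<open>P\<close>, hence so does their average.\<close>

lemma code_converse: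
  fixes P :: "('e::finite \<times> 'f::finite) pmf"
    and W :: "'x::finite \<Rightarrow> 'e \<times> 'f \<Rightarrow> ('y::finite \<times> 'z::finite) pmf"
  assumes W: "\<And>x s. W x s = map_pmf (Pair (y x (fst s))) (PZ x (fst s) (snd s))"
    and n: "0 < n" and code: "is_code n R enc dec est" and \<epsilon>: "0 \<le> \<epsilon>" "\<epsilon> \<le> 1"
    and err: "measure_pmf.prob (code_law P W n R enc dec est) {(m, m', s, t). m \<noteq> m'} \<le> \<epsilon>"
    and dist: "measure_pmf.expectation (code_law P W n R enc dec est) (\<lambda>(m, m', s, t). avg_distortion n d s t) \<le> D"
    and marg: "map_pmf (\<lambda>(m, m', s, t). t) (code_law P W n R enc dec est) = iid n P"
  obtains PX PT where "map_pmf (\<lambda>(x, se, sf, v, z, t). t) (joint_law P y PZ PX PT) = P"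
    "measure_pmf.expectation (joint_law P y PZ PX PT) (\<lambda>(x, se, sf, v, z, t). d (se, sf) t) \<le> D"
    "(1 - \<epsilon>) * R - 2 / real n \<le> output_entropy P y PX"
proof -
  define M where "M = messages n R"
  define T where "T = transmission_law P PZ n M enc est"
  define out where "out s x = (\<lambda>i\<in>{..<n}. y (x i) (fst (s i)))" for x and s :: "nat \<Rightarrow> 'e \<times> 'f"
  have M: "finite M" "M \<noteq> {}" and ne: "messages n R \<noteq> {}" using code by (auto simp: M_def is_code_def)
  have Q: "code_law P W n R enc dec est = map_pmf (\<lambda>(m, s, x, z, t). (m, dec (out s x), s, t)) T"
    unfolding T_def M_def out_def by (rule code_law_eq_transmission) (rule W)
  have enc: "set_pmf (enc m s) \<subseteq> seqs n" if "m \<in> M" "s \<in> seqs n" for m s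
    using code that by (auto simp: is_code_def M_def)
  have est: "set_pmf (est x s z) \<subseteq> seqs n" if "x \<in> seqs n" "s \<in> seqs n" "z \<in> seqs n" for x s z
    using code that by (auto simp: is_code_def)
  have fT: "finite (set_pmf T)"
    unfolding T_def by (rule finite_subset[OF set_transmission_law_subset]) (use M enc est in auto)
  obtain PX PT where \<phi>: "\<And>\<phi> :: _ \<Rightarrow> _ \<Rightarrow> _ \<Rightarrow> real.
    measure_pmf.expectation (joint_law P y PZ PX PT) (\<lambda>(x, se, sf, v, z, t). \<phi> (se, sf) x t) =
    measure_pmf.expectation T (\<lambda>(m, s, x, z, t). \<Sum>i<n. \<phi> (s i) (x i) (t i)) / real n"
    using single_letterization[OF n fT[unfolded T_def]] unfolding T_def by blast
  let ?J = "joint_law P y PZ PX PT"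
  have "map_pmf (\<lambda>(x, se, sf, v, z, t). t) ?J = P"
  proof (rule pmf_eqI)
    fix b
    have "pmf (map_pmf (\<lambda>(x, se, sf, v, z, t). t) ?J) b =
        measure_pmf.expectation ?J (\<lambda>(x, se, sf, v, z, t). of_bool (t = b))"
      by (simp add: pmf_map prob_eq_expectation vimage_def case_prod_unfold)
    also have "\<dots> = measure_pmf.expectation T (\<lambda>(m, s, x, z, t). \<Sum>i<n. of_bool (t i = b)) / real n"
      by (rule \<phi>)
    also have "measure_pmf.expectation T (\<lambda>(m, s, x, z, t). \<Sum>i<n. of_bool (t i = b)) =
       measure_pmf.expectation (map_pmf (\<lambda>(m, m', s, t). t) (code_law P W n R enc dec est)) (\<lambda>t. \<Sum>i<n. of_bool (t i = b) :: real)"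
      unfolding Q by (simp add: case_prod_unfold)
    also have "\<dots> = (\<Sum>i<n. measure_pmf.expectation P (\<lambda>a. of_bool (a = b)))"
      unfolding marg iid_def
      by (subst expectation_sum_finite) (auto simp: expectation_Pi_pmf_component[where g = "\<lambda>a. of_bool (a = b)"] intro!: finite_set_Pi_pmf)
    also have "\<dots> / real n = measure_pmf.expectation P (\<lambda>a. of_bool (a \<in> {b}))"
      using n by simp
    also have "\<dots> = pmf P b"
      unfolding prob_eq_expectation[symmetric] by (simp add: measure_pmf_single)
    finally show "pmf (map_pmf (\<lambda>(x, se, sf, v, z, t). t) ?J) b = pmf P b" .
  qed
  moreover have "measure_pmf.expectation ?J (\<lambda>(x, se, sf, v, z, t). d (se, sf) t) \<le> D"
    using dist unfolding Q \<phi>[of "\<lambda>s x t. d s t"] by (simp add: case_prod_unfold avg_distortion_def)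
  moreover have "(1 - \<epsilon>) * R - 2 / real n \<le> output_entropy P y PX"
  proof -
    let ?q = "output_law y PX"
    \<comment> \<open>Gibbs' inequality takes logarithms of the reference probabilities along the
      block. Output values of reference probability 0 have mass 0 under the averaged law, hence at
      every letter of the code.\<close>
    have "measure_pmf.expectation ?J (\<lambda>(x, se, sf, v, z, t). of_bool (pmf (?q se) (y x se) = 0)) = (0::real)"
    proof -
      have "measure_pmf.expectation ?J (\<lambda>(x, se, sf, v, z, t). of_bool (pmf (?q se) (y x se) = 0)) =
        measure_pmf.expectation ?J (\<lambda>_. 0 :: real)"
        by (intro Bochner_Integration.integral_cong_AE AE_pmfI)
           (auto simp: joint_law_def output_law_def pmf_eq_0_set_pmf)
      thus ?thesis by simp
    qed
    hence "measure_pmf.expectation T (\<lambda>(m, s, x, z, t). \<Sum>i<n. of_bool (pmf (?q (fst (s i))) (y (x i) (fst (s i))) = 0)) = (0::real)"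
      using \<phi>[of "\<lambda>s x t. of_bool (pmf (?q (fst s)) (y x (fst s)) = 0)"] n by simp
    hence "AE u in measure_pmf T. (case u of (m, s, x, z, t) \<Rightarrow>
        \<Sum>i<n. of_bool (pmf (?q (fst (s i))) (y (x i) (fst (s i))) = 0)) = (0::real)"
      by (subst (asm) integral_nonneg_eq_0_iff_AE)
         (auto simp: integrable_measure_pmf_finite[OF fT] case_prod_unfold intro!: sum_nonneg AE_pmfI)
    hence pos: "0 < pmf (?q (fst (s i))) (y (x i) (fst (s i)))" if "(m, s, x, z, t) \<in> set_pmf T" "i < n" for m s x z t i
      using that by (force simp: AE_measure_pmf_iff sum_nonneg_eq_0_iff pmf_positive_iff set_pmf_iff)
    define K where "K = real (card M)"
    define H where "H = output_entropy P y PX"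
    define p where "p = measure_pmf.expectation T (\<lambda>(m, s, x, z, t). of_bool (m \<noteq> dec (out s x)) :: real)"
    have K1: "1 \<le> K" using M by (simp add: K_def Suc_le_eq card_gt_0_iff)
    have "ln K - ln 2 - p * ln K \<le>
       measure_pmf.expectation T (\<lambda>(m, s, x, z, t). \<Sum>i<n. - ln (pmf (?q (fst (s i))) (y (x i) (fst (s i)))))"
      unfolding K_def p_def T_def out_def
    proof (rule entropy_converse)
      show "finite (set_pmf (enc m s))" if "m \<in> M" "s \<in> seqs n" for m s
        using enc[OF that] by (rule finite_subset) simp
      show "dec v \<in> M" if "v \<in> seqs n" for v using code that by (simp add: is_code_def M_def)
    qed (use M fT pos in \<open>auto simp: T_def\<close>)
    also have "\<dots> = real n * (ln 2 * H)"
    proof -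
      have "H = measure_pmf.expectation T (\<lambda>(m, s, x, z, t). \<Sum>i<n. - log 2 (pmf (?q (fst (s i))) (y (x i) (fst (s i))))) / real n"
        unfolding H_def output_entropy_joint_law[of P y PX PZ PT]
        using \<phi>[of "\<lambda>s x t. - log 2 (pmf (?q (fst s)) (y x (fst s)))"] by simp
      also have "measure_pmf.expectation T (\<lambda>(m, s, x, z, t). \<Sum>i<n. - log 2 (pmf (?q (fst (s i))) (y (x i) (fst (s i))))) =
        measure_pmf.expectation T (\<lambda>(m, s, x, z, t). \<Sum>i<n. - ln (pmf (?q (fst (s i))) (y (x i) (fst (s i))))) / ln 2"
        by (simp add: case_prod_unfold log_def sum_divide_distrib[symmetric] sum_negf del: Bochner_Integration.integral_sum)
      finally show ?thesis using n by simp
    qed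
    finally have 1: "(1 - p) * ln K - ln 2 \<le> real n * (ln 2 * H)" by (simp add: algebra_simps)
    have "p \<le> \<epsilon>"
      using err unfolding Q prob_eq_expectation by (simp add: p_def case_prod_unfold)
    hence "(1 - \<epsilon>) * ln K \<le> (1 - p) * ln K" using K1 by (intro mult_right_mono) auto
    moreover have "(1 - \<epsilon>) * ((real n * R - 1) * ln 2) \<le> (1 - \<epsilon>) * ln K"
    proof (intro mult_left_mono)
      have "(real n * R - 1) * ln 2 = ln (2 powr (real n * R) / 2)"
        by (simp add: ln_div ln_powr algebra_simps)
      also have "\<dots> \<le> ln K"
        using half_powr_le_card_messages[OF ne] K1 by (subst ln_le_cancel_iff) (auto simp: K_def M_def)
      finally show "(real n * R - 1) * ln 2 \<le> ln K" .
    qed (use \<epsilon> in simp)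
    ultimately have "((1 - \<epsilon>) * (real n * R - 1) - 1) * ln 2 \<le> (real n * H) * ln 2"
      using 1 by (simp add: algebra_simps)
    hence "(1 - \<epsilon>) * (real n * R - 1) - 1 \<le> real n * H"
      by (subst (asm) mult_le_cancel_right) auto
    hence "(1 - \<epsilon>) * R * real n - 2 \<le> real n * H"
      using \<epsilon> by (simp add: algebra_simps)
    thus ?thesis using n by (simp add: H_def field_simps)
  qed
  ultimately show ?thesis using that by blast
qed

lemma achievable_converse:
  fixes P :: "('e::finite \<times> 'f::finite) pmf"
    and W :: "'x::finite \<Rightarrow> 'e \<times> 'f \<Rightarrow> ('y::finite \<times> 'z::finite) pmf"
  assumes W: "\<And>x s. W x s = map_pmf (Pair (y x (fst s))) (PZ x (fst s) (snd s))"
    and ach: "achievable P W d R D" and \<eta>: "0 < \<eta>"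
  obtains PX PT where "0 \<le> R" "map_pmf (\<lambda>(x, se, sf, v, z, t). t) (joint_law P y PZ PX PT) = P"
    "measure_pmf.expectation (joint_law P y PZ PX PT) (\<lambda>(x, se, sf, v, z, t). d (se, sf) t) \<le> D"
    "R - \<eta> \<le> output_entropy P y PX"
proof -
  \<comment> \<open>The error loss \<open>\<epsilon> * R\<close> and the block loss
    \<open>2 / real n\<close> each receive half of \<open>\<eta>\<close>; the added 1 keeps the
    denominator positive at \<open>R = 0\<close>.\<close>
  define \<epsilon> where "\<epsilon> = min 1 (\<eta> / (2 * (\<bar>R\<bar> + 1)))"
  have "\<epsilon> * (\<bar>R\<bar> + 1) \<le> \<eta> / (2 * (\<bar>R\<bar> + 1)) * (\<bar>R\<bar> + 1)"
    unfolding \<epsilon>_def by (intro mult_right_mono) auto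
  also have "\<dots> = \<eta> / 2"
    using abs_ge_zero[of R] by (simp add: field_simps add_eq_0_iff)
  finally have \<epsilon>: "0 < \<epsilon>" "\<epsilon> \<le> 1" "\<epsilon> * (\<bar>R\<bar> + 1) \<le> \<eta> / 2"
    using \<eta> by (auto simp: \<epsilon>_def)
  have "\<forall>\<^sub>F n in sequentially. 2 / real n < \<eta> / 2"
  proof -
    have "(\<lambda>n. 2 / real n) \<longlonglongrightarrow> 0" by real_asymp
    thus ?thesis using \<eta> by (intro order_tendstoD) auto
  qed
  moreover have "\<forall>\<^sub>F n::nat in sequentially. 0 < n" by (rule eventually_gt_at_top)
  moreover note ach[unfolded achievable_def, rule_format, OF \<epsilon>(1)]
  ultimately have "\<forall>\<^sub>F n in sequentially. 2 / real n < \<eta> / 2 \<and> 0 < n \<and>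
    (\<exists>enc dec est. is_code n R enc dec est \<and>
        (let Q = code_law P W n R enc dec est in
           measure_pmf.prob Q {(m, m', s, t). m \<noteq> m'} \<le> \<epsilon> \<and>
           measure_pmf.expectation Q (\<lambda>(m, m', s, t). avg_distortion n d s t) \<le> D \<and>
           map_pmf (\<lambda>(m, m', s, t). t) Q = iid n P))"
    by eventually_elim blast
  then obtain n where "2 / real n < \<eta> / 2 \<and> 0 < n \<and>
    (\<exists>enc dec est. is_code n R enc dec est \<and>
        (let Q = code_law P W n R enc dec est in
           measure_pmf.prob Q {(m, m', s, t). m \<noteq> m'} \<le> \<epsilon> \<and>
           measure_pmf.expectation Q (\<lambda>(m, m', s, t). avg_distortion n d s t) \<le> D \<and>
           map_pmf (\<lambda>(m, m', s, t). t) Q = iid n P))"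
    unfolding eventually_sequentially by blast
  then obtain enc dec est where n: "2 / real n < \<eta> / 2" "0 < n" and code: "is_code n R enc dec est"
    "measure_pmf.prob (code_law P W n R enc dec est) {(m, m', s, t). m \<noteq> m'} \<le> \<epsilon>"
    "measure_pmf.expectation (code_law P W n R enc dec est) (\<lambda>(m, m', s, t). avg_distortion n d s t) \<le> D"
    "map_pmf (\<lambda>(m, m', s, t). t) (code_law P W n R enc dec est) = iid n P"
    unfolding Let_def by blast
  have R: "0 \<le> R" using code(1) n(2) by (auto simp: is_code_def messages_nonempty_iff)
  obtain PX PT where J: "map_pmf (\<lambda>(x, se, sf, v, z, t). t) (joint_law P y PZ PX PT) = P"
    "measure_pmf.expectation (joint_law P y PZ PX PT) (\<lambda>(x, se, sf, v, z, t). d (se, sf) t) \<le> D"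
    "(1 - \<epsilon>) * R - 2 / real n \<le> output_entropy P y PX"
    using code_converse[OF W n(2) code(1) _ \<epsilon>(2) code(2-4)] \<epsilon>(1) by (auto intro: less_imp_le)
  have "R - \<eta> \<le> (1 - \<epsilon>) * R - 2 / real n"
    using \<epsilon> n(1) R by (simp add: algebra_simps)
  with J R show ?thesis using that by force
qed

section \<open>Limits of single-letter laws\<close>

text \<open>Bolzano-Weierstrass in the unit cube: over finite alphabets, nonnegativity and total
  mass 1 survive in the limit.\<close>

lemma pmf_family_compact:
  fixes f :: "nat \<Rightarrow> 'i::finite \<Rightarrow> 'a::finite pmf"
  obtains r g where "strict_mono (r :: nat \<Rightarrow> nat)" "\<And>i a. (\<lambda>k. pmf (f (r k) i) a) \<longlonglongrightarrow> pmf (g i) a"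
proof -
  define F where "F k = (\<chi> w. pmf (f k (fst w)) (snd w))" for k
  have "F k \<in> cbox 0 1" for k
    by (auto simp: F_def mem_box_cart pmf_le_1)
  moreover have "seq_compact (cbox 0 1 :: (real ^ ('i \<times> 'a)) set)"
    by (simp add: compact_imp_seq_compact)
  ultimately obtain l r where r: "strict_mono r" and l: "(F \<circ> r) \<longlonglongrightarrow> l"
    unfolding seq_compact_def by metis
  have lim: "(\<lambda>k. pmf (f (r k) i) a) \<longlonglongrightarrow> l $ (i, a)" for i a
    using tendsto_vec_nth[OF l, of "(i, a)"] by (simp add: F_def o_def)
  define g where "g i = embed_pmf (\<lambda>a. l $ (i, a))" for i
  have nn: "0 \<le> l $ (i, a)" for i a
    by (rule LIMSEQ_le_const[OF lim]) auto
  have "(\<Sum>a\<in>UNIV. l $ (i, a)) = 1" for i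
  proof -
    have "(\<lambda>k. \<Sum>a\<in>UNIV. pmf (f (r k) i) a) \<longlonglongrightarrow> (\<Sum>a\<in>UNIV. l $ (i, a))"
      by (intro tendsto_sum lim)
    thus ?thesis by (simp add: sum_pmf_UNIV LIMSEQ_const_iff)
  qed
  hence "pmf (g i) a = l $ (i, a)" for i a
    unfolding g_def using nn
    by (subst pmf_embed_pmf) (auto simp: nn_integral_count_space_finite)
  thus ?thesis using that[OF r] lim by metis
qed

text \<open>The logarithm is discontinuous at 0, but \<open>x * log 2 x\<close> tends to 0 from the
  right, which is its value there; nonnegativity keeps the sequence on that side.\<close>

lemma tendsto_mult_log:
  fixes a :: "nat \<Rightarrow> real"
  assumes a: "a \<longlonglongrightarrow> l" and nn: "\<And>k. 0 \<le> a k"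
  shows "(\<lambda>k. a k * - log 2 (a k)) \<longlonglongrightarrow> l * - log 2 l"
proof (cases "l = 0")
  case False
  thus ?thesis using a by (intro tendsto_intros) auto
next
  case True
  have *: "((\<lambda>x::real. x * - log 2 x) \<longlongrightarrow> 0) (at_right 0)"
    unfolding log_def by real_asymp
  have "((\<lambda>x::real. x * - log 2 x) \<longlongrightarrow> 0) (at 0 within {0..})"
    using * by (simp add: at_within_Ici_at_right)
  hence "continuous (at 0 within {0..}) (\<lambda>x::real. x * - log 2 x)"
    by (simp add: continuous_within)
  hence "((\<lambda>x. x * - log 2 x) \<circ> a) \<longlonglongrightarrow> 0 * - log 2 0"
    using a nn True by (auto simp: continuous_within_sequentially)
  thus ?thesis using True by (simp add: o_def)
qed

text \<open>Each probability of the joint law is a polynomial in the kernel entries, and the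
  alphabets are finite.\<close>

lemma tendsto_expectation_joint_law:
  fixes P :: "('e::finite \<times> 'f::finite) pmf" and PZ :: "'x::finite \<Rightarrow> 'e \<Rightarrow> 'f \<Rightarrow> 'z::finite pmf"
    and y :: "'x \<Rightarrow> 'e \<Rightarrow> 'y::finite" and \<phi> :: "_ \<Rightarrow> real"
  assumes "\<And>e x. (\<lambda>k. pmf (PX k e) x) \<longlonglongrightarrow> pmf (PX' e) x"
    and "\<And>x e z t. (\<lambda>k. pmf (PT k x e z) t) \<longlonglongrightarrow> pmf (PT' x e z) t"
  shows "(\<lambda>k. measure_pmf.expectation (joint_law P y PZ (PX k) (PT k)) \<phi>) \<longlonglongrightarrow>
    measure_pmf.expectation (joint_law P y PZ PX' PT') \<phi>"
proof -
  have "(\<lambda>k. pmf (joint_law P y PZ (PX k) (PT k)) w) \<longlonglongrightarrow> pmf (joint_law P y PZ PX' PT') w" for w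
  proof -
    obtain x se sf v z t where w: "w = (x, se, sf, v, z, t)" by (cases w) auto
    show ?thesis unfolding w pmf_joint_law by (intro tendsto_intros assms)
  qed
  thus ?thesis
    by (simp add: integral_measure_pmf[of UNIV] tendsto_sum tendsto_mult_right)
qed

lemma tendsto_output_entropy:
  fixes P :: "('e::finite \<times> 'f) pmf" and y :: "'x::finite \<Rightarrow> 'e \<Rightarrow> 'y::finite"
  assumes "\<And>e x. (\<lambda>k. pmf (PX k e) x) \<longlonglongrightarrow> pmf (PX' e) x"
  shows "(\<lambda>k. output_entropy P y (PX k)) \<longlonglongrightarrow> output_entropy P y PX'"
  unfolding output_entropy_def
proof (intro tendsto_sum tendsto_mult_left tendsto_mult_log)
  show "(\<lambda>k. pmf (output_law y (PX k) e) v) \<longlonglongrightarrow> pmf (output_law y PX' e) v" for e v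
    unfolding output_law_def pmf_map_finite[OF finite subset_UNIV] by (intro tendsto_intros assms)
qed auto

lemma achievable_mono:
  assumes "achievable P W d R D" "D \<le> D'"
  shows "achievable P W d R D'"
  unfolding achievable_def
proof (intro allI impI)
  fix \<epsilon> :: real assume "0 < \<epsilon>"
  from assms(1)[unfolded achievable_def, rule_format, OF this]
  show "\<forall>\<^sub>F n in sequentially. \<exists>enc dec est. is_code n R enc dec est \<and>
        (let Q = code_law P W n R enc dec est in
           measure_pmf.prob Q {(m, m', s, t). m \<noteq> m'} \<le> \<epsilon> \<and>
           measure_pmf.expectation Q (\<lambda>(m, m', s, t). avg_distortion n d s t) \<le> D' \<and>
           map_pmf (\<lambda>(m, m', s, t). t) Q = iid n P)"
    by eventually_elim (use assms(2) in \<open>auto simp: Let_def intro: order_trans\<close>)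
qed

text \<open>The limit is taken in the kernels, not in the joint laws, so the limit law has the
  required factorization by construction, even where conditional laws are undetermined.\<close>

lemma closure_achievable_imp_joint_law:
  fixes P :: "('e::finite \<times> 'f::finite) pmf"
    and W :: "'x::finite \<Rightarrow> 'e \<times> 'f \<Rightarrow> ('y::finite \<times> 'z::finite) pmf"
  assumes W: "\<And>x s. W x s = map_pmf (Pair (y x (fst s))) (PZ x (fst s) (snd s))"
    and cl: "(R, D) \<in> closure {(R', D'). achievable P W d R' D'}"
  obtains PX PT where "0 \<le> R" "map_pmf (\<lambda>(x, se, sf, v, z, t). t) (joint_law P y PZ PX PT) = P"
    "measure_pmf.expectation (joint_law P y PZ PX PT) (\<lambda>(x, se, sf, v, z, t). d (se, sf) t) \<le> D"
    "R \<le> output_entropy P y PX"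
proof -
  obtain w where w: "\<And>k. w k \<in> {(R', D'). achievable P W d R' D'}" and wl: "w \<longlonglongrightarrow> (R, D)"
    using cl unfolding closure_sequential by blast
  define Rs where "Rs k = fst (w k)" for k
  define Ds where "Ds k = snd (w k)" for k
  have ach: "achievable P W d (Rs k) (Ds k)" for k
    using w[of k] by (auto simp: Rs_def Ds_def case_prod_unfold)
  have Rl: "Rs \<longlonglongrightarrow> R" and Dl: "Ds \<longlonglongrightarrow> D"
    using tendsto_fst[OF wl] tendsto_snd[OF wl] by (simp_all add: Rs_def[abs_def] Ds_def[abs_def])
  have "\<exists>PX PT. 0 \<le> Rs k \<and> map_pmf (\<lambda>(x, se, sf, v, z, t). t) (joint_law P y PZ PX PT) = P \<and>
    measure_pmf.expectation (joint_law P y PZ PX PT) (\<lambda>(x, se, sf, v, z, t). d (se, sf) t) \<le> Ds k \<and>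
    Rs k - 1 / real (Suc k) \<le> output_entropy P y PX" for k
    using achievable_converse[OF W ach[of k], of "1 / real (Suc k)"] by (metis zero_less_divide_1_iff of_nat_0_less_iff zero_less_Suc)
  then obtain PX PT where R0: "\<And>k. 0 \<le> Rs k"
    and mg: "\<And>k. map_pmf (\<lambda>(x, se, sf, v, z, t). t) (joint_law P y PZ (PX k) (PT k)) = P"
    and ds: "\<And>k. measure_pmf.expectation (joint_law P y PZ (PX k) (PT k)) (\<lambda>(x, se, sf, v, z, t). d (se, sf) t) \<le> Ds k"
    and en: "\<And>k. Rs k - 1 / real (Suc k) \<le> output_entropy P y (PX k)"
    by metis
  obtain r1 PX' where r1: "strict_mono r1" "\<And>e x. (\<lambda>k. pmf (PX (r1 k) e) x) \<longlonglongrightarrow> pmf (PX' e) x"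
    using pmf_family_compact[of PX] by blast
  \<comment> \<open>A refinement of the first subsequence, along which \<open>PX\<close> still
    converges. The three arguments of \<open>PT\<close> are packed into one finite index.\<close>
  obtain r2 g where r2: "strict_mono r2"
    "\<And>i t. (\<lambda>k. pmf (case i of (x, e, z) \<Rightarrow> PT (r1 (r2 k)) x e z) t) \<longlonglongrightarrow> pmf (g i) t"
    using pmf_family_compact[of "\<lambda>k (x, e, z). PT (r1 k) x e z"] by blast
  define PT' where "PT' x e z = g (x, e, z)" for x e z
  define r where "r k = r1 (r2 k)" for k
  have r: "strict_mono r" using r1(1) r2(1) by (simp add: r_def strict_mono_def)
  have PXl: "(\<lambda>k. pmf (PX (r k) e) x) \<longlonglongrightarrow> pmf (PX' e) x" for e x
    using LIMSEQ_subseq_LIMSEQ[OF r1(2) r2(1)] by (simp add: r_def o_def)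
  have PTl: "(\<lambda>k. pmf (PT (r k) x e z) t) \<longlonglongrightarrow> pmf (PT' x e z) t" for x e z t
    using r2(2)[where i = "(x, e, z)"] by (simp add: r_def PT'_def)
  have E: "(\<lambda>k. measure_pmf.expectation (joint_law P y PZ (PX (r k)) (PT (r k))) \<phi>) \<longlonglongrightarrow>
    measure_pmf.expectation (joint_law P y PZ PX' PT') \<phi>" for \<phi> :: "_ \<Rightarrow> real"
    by (rule tendsto_expectation_joint_law) (rule PXl PTl)+
  have sub: "(Rs \<circ> r) \<longlonglongrightarrow> R" "(Ds \<circ> r) \<longlonglongrightarrow> D"
    using LIMSEQ_subseq_LIMSEQ[OF Rl r] LIMSEQ_subseq_LIMSEQ[OF Dl r] by auto
  have "0 \<le> R" by (rule LIMSEQ_le_const[OF Rl]) (use R0 in auto)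
  moreover have "map_pmf (\<lambda>(x, se, sf, v, z, t). t) (joint_law P y PZ PX' PT') = P"
  proof (rule pmf_eqI)
    fix b
    have m: "pmf (map_pmf (\<lambda>(x, se, sf, v, z, t). t) J) b =
        measure_pmf.expectation J (\<lambda>(x, se, sf, v, z, t). of_bool (t = b))" for J :: "('x \<times> 'e \<times> 'f \<times> 'y \<times> 'z \<times> 'e \<times> 'f) pmf"
      by (simp add: pmf_map prob_eq_expectation vimage_def case_prod_unfold)
    from E[of "\<lambda>(x, se, sf, v, z, t). of_bool (t = b)"]
    show "pmf (map_pmf (\<lambda>(x, se, sf, v, z, t). t) (joint_law P y PZ PX' PT')) b = pmf P b"
      unfolding m[symmetric] mg by (simp add: LIMSEQ_const_iff)
  qed
  moreover have "measure_pmf.expectation (joint_law P y PZ PX' PT') (\<lambda>(x, se, sf, v, z, t). d (se, sf) t) \<le> D"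
    by (rule LIMSEQ_le[OF E sub(2)]) (use ds in auto)
  moreover have "R \<le> output_entropy P y PX'"
  proof (rule LIMSEQ_le)
    have "(\<lambda>k. 1 / real (Suc k)) \<longlonglongrightarrow> 0" by real_asymp
    from LIMSEQ_subseq_LIMSEQ[OF this r] sub(1)
    have "(\<lambda>k. (Rs \<circ> r) k - ((\<lambda>k. 1 / real (Suc k)) \<circ> r) k) \<longlonglongrightarrow> R - 0" by (intro tendsto_diff)
    thus "(\<lambda>k. Rs (r k) - 1 / real (Suc (r k))) \<longlonglongrightarrow> R" by simp
    show "(\<lambda>k. output_entropy P y (PX (r k))) \<longlonglongrightarrow> output_entropy P y PX'"
      by (rule tendsto_output_entropy) (rule PXl)
  qed (use en in auto)
  ultimately show ?thesis using that by blast
qed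

lemma joint_law_imp_closure_achievable:
  fixes P :: "('e::finite \<times> 'f::finite) pmf"
    and W :: "'x::finite \<Rightarrow> 'e \<times> 'f \<Rightarrow> ('y::finite \<times> 'z::finite) pmf"
  assumes W: "\<And>x s. W x s = map_pmf (Pair (y x (fst s))) (PZ x (fst s) (snd s))"
    and J: "map_pmf (\<lambda>(x, se, sf, v, z, t). t) (joint_law P y PZ PX PT) = P"
    and D: "measure_pmf.expectation (joint_law P y PZ PX PT) (\<lambda>(x, se, sf, v, z, t). d (se, sf) t) \<le> D"
    and R: "0 \<le> R" "R \<le> output_entropy P y PX"
  shows "(R, D) \<in> closure {(R', D'). achievable P W d R' D'}"
  unfolding closure_approachable
proof (intro allI impI)
  fix \<epsilon> :: real assume \<epsilon>: "0 < \<epsilon>"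
  \<comment> \<open>Either 0 or strictly below the entropy, as
    \<open>achievable_below_entropy\<close> demands.\<close>
  define R' where "R' = max 0 (R - \<epsilon> / 2)"
  have "achievable P W d R' D"
    using achievable_mono[OF achievable_below_entropy[OF W J, of R' d] D] R \<epsilon> by (force simp: R'_def)
  moreover have "dist (R', D) (R, D) < \<epsilon>"
    using R \<epsilon> by (auto simp: dist_prod_def dist_real_def R'_def)
  ultimately show "\<exists>w\<in>{(R', D'). achievable P W d R' D'}. dist w (R, D) < \<epsilon>"
    by (intro bexI[of _ "(R', D)"]) auto
qed

theorem corollary2:
  fixes P :: "('e::finite \<times> 'f::finite) pmf"
    and W :: "'x::finite \<Rightarrow> 'e \<times> 'f \<Rightarrow> ('y::finite \<times> 'z::finite) pmf"
    and y :: "'x \<Rightarrow> 'e \<Rightarrow> 'y"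
    and PZ :: "'x \<Rightarrow> 'e \<Rightarrow> 'f \<Rightarrow> 'z pmf"
    and d :: "'e \<times> 'f \<Rightarrow> 'e \<times> 'f \<Rightarrow> real"
    and D :: real
  assumes d_nonneg: "\<And>s t. 0 \<le> d s t"
    and deterministic: "\<And>x se sf v z.
          pmf (W x (se, sf)) (v, z) = of_bool (v = y x se) * pmf (PZ x se sf) z"
    and "0 \<le> D"
  shows "C_NCR P W d D =
    {(R, 0) | R. 0 \<le> R \<and>
       (\<exists>J \<in> P_NCR_DE P y PZ.
          R \<le> cond_entropy J (\<lambda>(x, se, sf, v, z, t). v) (\<lambda>(x, se, sf, v, z, t). se) \<and>
          D \<ge> measure_pmf.expectation J (\<lambda>(x, se, sf, v, z, t). d (se, sf) t))}"
proof -
  have W: "W x s = map_pmf (Pair (y x (fst s))) (PZ x (fst s) (snd s))" for x s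
    by (cases s, rule pmf_eqI) (auto simp: deterministic pmf_map_Pair)
  have "(R, D) \<in> closure {(R', D'). achievable P W d R' D'} \<longleftrightarrow> 0 \<le> R \<and>
       (\<exists>J \<in> P_NCR_DE P y PZ.
          R \<le> cond_entropy J (\<lambda>(x, se, sf, v, z, t). v) (\<lambda>(x, se, sf, v, z, t). se) \<and>
          D \<ge> measure_pmf.expectation J (\<lambda>(x, se, sf, v, z, t). d (se, sf) t))" for R
  proof
    assume "(R, D) \<in> closure {(R', D'). achievable P W d R' D'}"
    from closure_achievable_imp_joint_law[where W = W and y = y and PZ = PZ, OF W this]
    obtain PX PT where "0 \<le> R" "map_pmf (\<lambda>(x, se, sf, v, z, t). t) (joint_law P y PZ PX PT) = P"
      "measure_pmf.expectation (joint_law P y PZ PX PT) (\<lambda>(x, se, sf, v, z, t). d (se, sf) t) \<le> D"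
      "R \<le> output_entropy P y PX" .
    thus "0 \<le> R \<and> (\<exists>J \<in> P_NCR_DE P y PZ.
          R \<le> cond_entropy J (\<lambda>(x, se, sf, v, z, t). v) (\<lambda>(x, se, sf, v, z, t). se) \<and>
          D \<ge> measure_pmf.expectation J (\<lambda>(x, se, sf, v, z, t). d (se, sf) t))"
      unfolding P_NCR_DE_eq
      by (intro conjI bexI[of _ "joint_law P y PZ PX PT"]) (auto simp: cond_entropy_joint_law)
  next
    assume "0 \<le> R \<and> (\<exists>J \<in> P_NCR_DE P y PZ.
          R \<le> cond_entropy J (\<lambda>(x, se, sf, v, z, t). v) (\<lambda>(x, se, sf, v, z, t). se) \<and>
          D \<ge> measure_pmf.expectation J (\<lambda>(x, se, sf, v, z, t). d (se, sf) t))"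
    then obtain PX PT where "0 \<le> R"
      and "map_pmf (\<lambda>(x, se, sf, v, z, t). t) (joint_law P y PZ PX PT) = P"
      and "measure_pmf.expectation (joint_law P y PZ PX PT) (\<lambda>(x, se, sf, v, z, t). d (se, sf) t) \<le> D"
      and "R \<le> output_entropy P y PX"
      unfolding P_NCR_DE_eq by (auto simp: cond_entropy_joint_law)
    thus "(R, D) \<in> closure {(R', D'). achievable P W d R' D'}"
      by (intro joint_law_imp_closure_achievable[where y = y and PZ = PZ and PX = PX and PT = PT] W)
  qed
  thus ?thesis unfolding C_NCR_def by simp
qed

end
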